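(* Let $k$ be a field of characteristic $p>0$ having at least $d$ elements. Then for any strict polynomial functors $P,Q$ over $k$ homogeneous of degree $d$, the natural inclusion $\mathrm{Hom}_{\mathcal P}(P,Q)\hookrightarrow\mathrm{Hom}_{\mathcal F}(P,Q)$ is an isomorphism.
   Context: $\mathcal{V}$ (resp. $\mathcal{V}^f$) is the category of (finite dimensional) $k$-vector spaces. $\mathcal{F}=\mathcal{F}(k)$ is the abelian category of all functors $\mathcal{V}^f\to\mathcal{V}$. Strict polynomial functors. A polynomial map $V\to W$ between finite dimensional spaces is an element of $S^*(V^\#)\otimes W$ (with $V^\#$ the linear dual), i.e. a morphism of the associated affine schemes; it is homogeneous of degree $d$ if it lies in $S^d(V^\#)\otimes W$. A strict polynomial functor $P$ consists of a space $P(V)\in\mathcal{V}^f$ for each $V\in\mathcal{V}^f$ and polynomial maps $P_{V,W}:\mathrm{Hom}_k(V,W)\to \mathrm{Hom}_k(P(V),P(W))$ compatible (as polynomial maps) with identities and composition. It is homogeneous of degree $d$ if all $P_{V,W}$ are, and of finite degree if the degrees of the $P_{V,W}$ are bounded. A morphism $P\to Q$ is a family of linear maps $f_V:P(V)\to Q(V)$ with $f_W\circ P_{V,W}(-)=Q_{V,W}(-)\circ f_V$ as polynomial maps. $\mathcal{P}=\mathcal{P}(k)$ is the abelian category of strict polynomial functors of finite degree. Evaluating polynomial maps on $k$-points gives the forgetful functor $\mathcal{P}\to\mathcal{F}$, and $\mathrm{Hom}_{\mathcal F}(P,Q)$ means natural transformations between the underlying functors. *)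

theory Defs
  imports
    "Jordan_Normal_Form.VS_Connect"
    "HOL-Library.Poly_Mapping"
    "HOL-Library.FuncSet"
begin

section \<open>Vector spaces\<close>

text \<open>The base field is the type \<open>'k\<close>, regarded as the ring record \<^term>\<open>class_ring\<close>. A functor is
  applied to all finite-dimensional vector spaces, and HOL does not quantify over types inside a
  formula, so vector spaces are module records with an explicit carrier in a type \<open>'v\<close>. This type
  and the type \<open>'w\<close> of the values of a functor are arbitrary; they play the role of universes.\<close>

definition fin_vec :: "('k::field, 'v) module set" where
  "fin_vec = {V. vectorspace class_ring V \<and> vectorspace.fin_dim class_ring V}"

text \<open>Maps are extensional (\<^const>\<open>undefined\<close> outside the carrier), so that equality of linear maps is
  equality of functions. The fields \<open>mult\<close> and \<open>one\<close> that a module record inherits from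
  rings carry no information; they are filled in as in \<^const>\<open>direct_sum\<close>.\<close>

definition hom_space :: "('k::field, 'v) module \<Rightarrow> ('k, 'w) module \<Rightarrow> ('k, 'v \<Rightarrow> 'w) module" where
  "hom_space V W =
    \<lparr>carrier = LinearCombinations.module_hom class_ring V W \<inter> extensional (carrier V),
     mult = (\<lambda>f g. \<lambda>x\<in>carrier V. \<zero>\<^bsub>W\<^esub>),
     one = (\<lambda>x\<in>carrier V. \<zero>\<^bsub>W\<^esub>),
     zero = (\<lambda>x\<in>carrier V. \<zero>\<^bsub>W\<^esub>),
     add = (\<lambda>f g. \<lambda>x\<in>carrier V. f x \<oplus>\<^bsub>W\<^esub> g x),
     smult = (\<lambda>c f. \<lambda>x\<in>carrier V. c \<odot>\<^bsub>W\<^esub> f x)\<rparr>"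

definition base_space :: "('k::field, 'k) module" where
  "base_space =
    \<lparr>carrier = UNIV, mult = (\<lambda>_ _. 0), one = 0, zero = 0, add = (+), smult = (*)\<rparr>"

definition dual :: "('k::field, 'v) module \<Rightarrow> ('k, 'v \<Rightarrow> 'k) module" where
  "dual V = hom_space V base_space"

definition dual_vector :: "('k::field, 'v) module \<Rightarrow> 'v set \<Rightarrow> 'v \<Rightarrow> 'v \<Rightarrow> 'k" where
  "dual_vector V B b =
    (THE l. l \<in> carrier (dual V) \<and> (\<forall>c\<in>B. l c = (if c = b then 1 else 0)))"


section \<open>Polynomial maps\<close>

text \<open>\<open>S\<^sup>*(V\<^sup>#) \<otimes> W\<close> by generators and relations: the free vector space on the symbols
  \<open>l\<^sub>1 \<cdots> l\<^sub>r \<otimes> w\<close>, with \<open>{#l\<^sub>1, \<dots>, l\<^sub>r#}\<close> a multiset of functionals on \<open>V\<close> and \<open>w \<in> W\<close>, modulo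
  linearity in every \<open>l\<^sub>i\<close> and in \<open>w\<close>.\<close>

type_synonym ('k, 'v, 'w) formal = "(('v \<Rightarrow> 'k) multiset \<times> 'w) \<Rightarrow>\<^sub>0 'k"

definition formals :: "('k::field, 'v) module \<Rightarrow> ('k, 'w) module \<Rightarrow> ('k, 'v, 'w) formal set" where
  "formals V W = {a. Poly_Mapping.keys a \<subseteq> {m. set_mset m \<subseteq> carrier (dual V)} \<times> carrier W}"

inductive_set relators :: "('k::field, 'v) module \<Rightarrow> ('k, 'w) module \<Rightarrow> ('k, 'v, 'w) formal set"
  for V :: "('k::field, 'v) module" and W :: "('k, 'w) module" where
  add_functional: "\<lbrakk>set_mset m \<subseteq> carrier (dual V); l \<in> carrier (dual V); l' \<in> carrier (dual V); w \<in> carrier W\<rbrakk> \<Longrightarrow>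
    Poly_Mapping.single (add_mset (l \<oplus>\<^bsub>dual V\<^esub> l') m, w) 1
      - Poly_Mapping.single (add_mset l m, w) 1 - Poly_Mapping.single (add_mset l' m, w) 1 \<in> relators V W"
| smult_functional: "\<lbrakk>set_mset m \<subseteq> carrier (dual V); l \<in> carrier (dual V); w \<in> carrier W\<rbrakk> \<Longrightarrow>
    Poly_Mapping.single (add_mset (c \<odot>\<^bsub>dual V\<^esub> l) m, w) 1 - Poly_Mapping.single (add_mset l m, w) c \<in> relators V W"
| add_vector: "\<lbrakk>set_mset m \<subseteq> carrier (dual V); w \<in> carrier W; w' \<in> carrier W\<rbrakk> \<Longrightarrow>
    Poly_Mapping.single (m, w \<oplus>\<^bsub>W\<^esub> w') 1
      - Poly_Mapping.single (m, w) 1 - Poly_Mapping.single (m, w') 1 \<in> relators V W"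
| smult_vector: "\<lbrakk>set_mset m \<subseteq> carrier (dual V); w \<in> carrier W\<rbrakk> \<Longrightarrow>
    Poly_Mapping.single (m, c \<odot>\<^bsub>W\<^esub> w) 1 - Poly_Mapping.single (m, w) c \<in> relators V W"

inductive_set relator_span :: "('k::field, 'v) module \<Rightarrow> ('k, 'w) module \<Rightarrow> ('k, 'v, 'w) formal set"
  for V :: "('k::field, 'v) module" and W :: "('k, 'w) module" where
  "0 \<in> relator_span V W"
| "\<lbrakk>a \<in> relator_span V W; r \<in> relators V W\<rbrakk> \<Longrightarrow> a + Poly_Mapping.map ((*) c) r \<in> relator_span V W"

definition formal_rel :: "('k::field, 'v) module \<Rightarrow> ('k, 'w) module \<Rightarrow> ('k, 'v, 'w) formal rel" where
  "formal_rel V W = {(a, b). a \<in> formals V W \<and> b \<in> formals V W \<and> a - b \<in> relator_span V W}"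

definition poly_maps :: "('k::field, 'v) module \<Rightarrow> ('k, 'w) module \<Rightarrow> ('k, 'v, 'w) formal set set" where
  "poly_maps V W = formals V W // formal_rel V W"

definition homogeneous :: "nat \<Rightarrow> ('k::field, 'v, 'w) formal set \<Rightarrow> bool" where
  "homogeneous d F \<longleftrightarrow> (\<exists>a\<in>F. \<forall>(m, w)\<in>Poly_Mapping.keys a. size m = d)"

text \<open>Evaluation at a \<open>k\<close>-point. The image below is a singleton because evaluation kills the
  relators.\<close>

definition formal_eval :: "('k::field, 'w) module \<Rightarrow> 'v \<Rightarrow> ('k, 'v, 'w) formal \<Rightarrow> 'w" where
  "formal_eval W v a = (\<Oplus>\<^bsub>W\<^esub>x\<in>Poly_Mapping.keys a.
    (Poly_Mapping.lookup a x * (\<Prod>l\<in>#fst x. l v)) \<odot>\<^bsub>W\<^esub> snd x)"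

definition pm_eval :: "('k::field, 'w) module \<Rightarrow> ('k, 'v, 'w) formal set \<Rightarrow> 'v \<Rightarrow> 'w" where
  "pm_eval W F v = the_elem (formal_eval W v ` F)"

text \<open>The operations on polynomial maps below are defined on representatives; saturating the set of
  results under \<^const>\<open>formal_rel\<close> yields a single class, since they respect the relations.\<close>

text \<open>\<open>v \<mapsto> f (F v)\<close> for a linear map \<open>f\<close> into \<open>W\<close>.\<close>

definition pm_post :: "('k::field, 'v) module \<Rightarrow> ('k, 'w) module \<Rightarrow> ('u \<Rightarrow> 'w) \<Rightarrow>
    ('k, 'v, 'u) formal set \<Rightarrow> ('k, 'v, 'w) formal set" where
  "pm_post V W f F = formal_rel V W ``
    ((\<lambda>a. \<Sum>x\<in>Poly_Mapping.keys a. Poly_Mapping.single (fst x, f (snd x)) (Poly_Mapping.lookup a x)) ` F)"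

text \<open>\<open>v \<mapsto> G (F v)\<close>: in \<open>G = \<Sum> l\<^sub>1 \<cdots> l\<^sub>r \<otimes> x\<close> every functional \<open>l\<^sub>i\<close> is replaced by the polynomial
  \<open>l\<^sub>i \<circ> F\<close>. Here \<open>('v \<Rightarrow> 'k) multiset \<Rightarrow>\<^sub>0 'k\<close> is the polynomial ring whose variables are the functions
  \<open>'v \<Rightarrow> 'k\<close>, with the convolution product.\<close>

definition pullback_functional ::
    "('k::field, 'v, 'w) formal \<Rightarrow> ('w \<Rightarrow> 'k) \<Rightarrow> (('v \<Rightarrow> 'k) multiset \<Rightarrow>\<^sub>0 'k)" where
  "pullback_functional b l =
    (\<Sum>y\<in>Poly_Mapping.keys b. Poly_Mapping.single (fst y) (Poly_Mapping.lookup b y * l (snd y)))"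

definition formal_comp ::
    "('k::field, 'w, 'x) formal \<Rightarrow> ('k, 'v, 'w) formal \<Rightarrow> ('k, 'v, 'x) formal" where
  "formal_comp a b = (\<Sum>x\<in>Poly_Mapping.keys a.
    let q = (\<Prod>l\<in>#fst x. pullback_functional b l) in
      \<Sum>m\<in>Poly_Mapping.keys q.
        Poly_Mapping.single (m, snd x) (Poly_Mapping.lookup a x * Poly_Mapping.lookup q m))"

definition pm_comp :: "('k::field, 'v) module \<Rightarrow> ('k, 'x) module \<Rightarrow>
    ('k, 'w, 'x) formal set \<Rightarrow> ('k, 'v, 'w) formal set \<Rightarrow> ('k, 'v, 'x) formal set" where
  "pm_comp V X G F = formal_rel V X `` {formal_comp a b |a b. a \<in> G \<and> b \<in> F}"

text \<open>\<open>(v, v') \<mapsto> \<beta> (G v) (F v')\<close> for a bilinear map \<open>\<beta>\<close> into \<open>X\<close>, as a polynomial map on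
  \<open>V \<oplus> V'\<close>.\<close>

definition formal_bilinear :: "('k::field, 'v) module \<Rightarrow> ('k, 'u) module \<Rightarrow> ('w \<Rightarrow> 'y \<Rightarrow> 'x) \<Rightarrow>
    ('k, 'v, 'w) formal \<Rightarrow> ('k, 'u, 'y) formal \<Rightarrow> ('k, 'v \<times> 'u, 'x) formal" where
  "formal_bilinear V V' \<beta> a b =
    (\<Sum>x\<in>Poly_Mapping.keys a. \<Sum>y\<in>Poly_Mapping.keys b.
      Poly_Mapping.single
        (image_mset (\<lambda>l. \<lambda>v\<in>carrier V \<times> carrier V'. l (fst v)) (fst x)
          + image_mset (\<lambda>l. \<lambda>v\<in>carrier V \<times> carrier V'. l (snd v)) (fst y), \<beta> (snd x) (snd y))
        (Poly_Mapping.lookup a x * Poly_Mapping.lookup b y))"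

definition pm_bilinear :: "('k::field, 'v) module \<Rightarrow> ('k, 'u) module \<Rightarrow> ('k, 'x) module \<Rightarrow> ('w \<Rightarrow> 'y \<Rightarrow> 'x) \<Rightarrow>
    ('k, 'v, 'w) formal set \<Rightarrow> ('k, 'u, 'y) formal set \<Rightarrow> ('k, 'v \<times> 'u, 'x) formal set" where
  "pm_bilinear V V' X \<beta> G F =
    formal_rel (direct_sum V V') X `` {formal_bilinear V V' \<beta> a b |a b. a \<in> G \<and> b \<in> F}"

text \<open>The identity polynomial map is the canonical element \<open>\<Sum> b\<^sup># \<otimes> b\<close> of \<open>V\<^sup># \<otimes> V\<close>, which does not
  depend on the basis.\<close>

definition pm_id :: "('k::field, 'v) module \<Rightarrow> ('k, 'v, 'v) formal set" where
  "pm_id V = formal_rel V V ``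
    {\<Sum>b\<in>B. Poly_Mapping.single ({#dual_vector V B b#}, b) 1 |B. finite B \<and> vectorspace.basis class_ring V B}"

text \<open>Composition \<open>Hom(W, X) \<oplus> Hom(V, W) \<rightarrow> Hom(V, X)\<close> as a polynomial map.\<close>

definition pm_composition ::
    "('k::field, 'v) module \<Rightarrow> ('k, 'w) module \<Rightarrow> ('k, 'x) module \<Rightarrow>
      ('k, ('w \<Rightarrow> 'x) \<times> ('v \<Rightarrow> 'w), 'v \<Rightarrow> 'x) formal set" where
  "pm_composition V W X =
    pm_bilinear (hom_space W X) (hom_space V W) (hom_space V X) (compose (carrier V))
      (pm_id (hom_space W X)) (pm_id (hom_space V W))"


section \<open>Strict polynomial functors\<close>

record (overloaded) ('k::zero, 'v, 'w) strict_functor =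
  sobj :: "('k, 'v) module \<Rightarrow> ('k, 'w) module"
  smap :: "('k, 'v) module \<Rightarrow> ('k, 'v) module \<Rightarrow> ('k, 'v \<Rightarrow> 'v, 'w \<Rightarrow> 'w) formal set"

text \<open>The last clause is the equation \<open>P(g \<circ> f) = P(g) \<circ> P(f)\<close> of polynomial maps on
  \<open>Hom(W, X) \<oplus> Hom(V, W)\<close>.\<close>

definition strict_poly_functor :: "('k::field, 'v, 'w) strict_functor \<Rightarrow> bool" where
  "strict_poly_functor P \<longleftrightarrow>
    (\<forall>V\<in>fin_vec. sobj P V \<in> fin_vec) \<and>
    (\<forall>V\<in>fin_vec. \<forall>W\<in>fin_vec.
      smap P V W \<in> poly_maps (hom_space V W) (hom_space (sobj P V) (sobj P W))) \<and>
    (\<forall>V\<in>fin_vec.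
      pm_eval (hom_space (sobj P V) (sobj P V)) (smap P V V) (\<lambda>x\<in>carrier V. x)
        = (\<lambda>x\<in>carrier (sobj P V). x)) \<and>
    (\<forall>V\<in>fin_vec. \<forall>W\<in>fin_vec. \<forall>X\<in>fin_vec.
      pm_comp (direct_sum (hom_space W X) (hom_space V W)) (hom_space (sobj P V) (sobj P X))
          (smap P V X) (pm_composition V W X)
        = pm_bilinear (hom_space W X) (hom_space V W) (hom_space (sobj P V) (sobj P X))
            (compose (carrier (sobj P V))) (smap P W X) (smap P V W))"

definition homogeneous_functor :: "nat \<Rightarrow> ('k::field, 'v, 'w) strict_functor \<Rightarrow> bool" where
  "homogeneous_functor d P \<longleftrightarrow> (\<forall>V\<in>fin_vec. \<forall>W\<in>fin_vec. homogeneous d (smap P V W))"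

record ('k, 'v, 'w) vect_functor =
  fobj :: "('k, 'v) module \<Rightarrow> ('k, 'w) module"
  fmap :: "('k, 'v) module \<Rightarrow> ('k, 'v) module \<Rightarrow> ('v \<Rightarrow> 'v) \<Rightarrow> ('w \<Rightarrow> 'w)"

definition forget :: "('k::field, 'v, 'w) strict_functor \<Rightarrow> ('k, 'v, 'w) vect_functor" where
  "forget P = \<lparr>fobj = sobj P,
    fmap = (\<lambda>V W. \<lambda>f\<in>carrier (hom_space V W). pm_eval (hom_space (sobj P V) (sobj P W)) (smap P V W) f)\<rparr>"


section \<open>Spaces of morphisms\<close>

text \<open>All families of linear maps \<open>\<eta>\<^sub>V : P(V) \<rightarrow> Q(V)\<close> with \<open>V\<close> ranging over \<^const>\<open>fin_vec\<close>.\<close>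

definition family_space :: "(('k::field, 'v) module \<Rightarrow> ('k, 'w) module) \<Rightarrow> (('k, 'v) module \<Rightarrow> ('k, 'u) module) \<Rightarrow>
    ('k, ('k, 'v) module \<Rightarrow> 'w \<Rightarrow> 'u) module" where
  "family_space P Q =
    \<lparr>carrier = (\<Pi>\<^sub>E V\<in>fin_vec. carrier (hom_space (P V) (Q V))),
     mult = (\<lambda>\<eta> \<theta>. \<lambda>V\<in>fin_vec. \<zero>\<^bsub>hom_space (P V) (Q V)\<^esub>),
     one = (\<lambda>V\<in>fin_vec. \<zero>\<^bsub>hom_space (P V) (Q V)\<^esub>),
     zero = (\<lambda>V\<in>fin_vec. \<zero>\<^bsub>hom_space (P V) (Q V)\<^esub>),
     add = (\<lambda>\<eta> \<theta>. \<lambda>V\<in>fin_vec. \<eta> V \<oplus>\<^bsub>hom_space (P V) (Q V)\<^esub> \<theta> V),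
     smult = (\<lambda>c \<eta>. \<lambda>V\<in>fin_vec. c \<odot>\<^bsub>hom_space (P V) (Q V)\<^esub> \<eta> V)\<rparr>"

definition strict_Hom :: "('k::field, 'v, 'w) strict_functor \<Rightarrow> ('k, 'v, 'u) strict_functor \<Rightarrow>
    ('k, ('k, 'v) module \<Rightarrow> 'w \<Rightarrow> 'u) module" where
  "strict_Hom P Q = (family_space (sobj P) (sobj Q))
    \<lparr>carrier := {\<eta> \<in> carrier (family_space (sobj P) (sobj Q)).
      \<forall>V\<in>fin_vec. \<forall>W\<in>fin_vec.
        pm_post (hom_space V W) (hom_space (sobj P V) (sobj Q W))
            (\<lambda>\<phi>. compose (carrier (sobj P V)) (\<eta> W) \<phi>) (smap P V W)
          = pm_post (hom_space V W) (hom_space (sobj P V) (sobj Q W))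
              (\<lambda>\<psi>. compose (carrier (sobj P V)) \<psi> (\<eta> V)) (smap Q V W)}\<rparr>"

definition vect_Hom :: "('k::field, 'v, 'w) vect_functor \<Rightarrow> ('k, 'v, 'u) vect_functor \<Rightarrow>
    ('k, ('k, 'v) module \<Rightarrow> 'w \<Rightarrow> 'u) module" where
  "vect_Hom F G = (family_space (fobj F) (fobj G))
    \<lparr>carrier := {\<eta> \<in> carrier (family_space (fobj F) (fobj G)).
      \<forall>V\<in>fin_vec. \<forall>W\<in>fin_vec. \<forall>f\<in>carrier (hom_space V W).
        compose (carrier (fobj F V)) (\<eta> W) (fmap F V W f)
          = compose (carrier (fobj F V)) (fmap G V W f) (\<eta> V)}\<rparr>"

text \<open>The forgetful functor keeps the components of a morphism.\<close>

definition forget_morphism :: "(('k::field, 'v) module \<Rightarrow> 'w \<Rightarrow> 'u) \<Rightarrow> (('k, 'v) module \<Rightarrow> 'w \<Rightarrow> 'u)" where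
  "forget_morphism \<eta> = \<eta>"

end

theory Submission
  imports Defs
begin

text \<open>A family of linear maps \<open>\<eta>\<^sub>V : P(V) \<rightarrow> Q(V)\<close> lies in either space of morphisms iff, for all \<open>V\<close> and
\<open>W\<close>, the two expressions \<open>\<eta>\<^sub>W \<circ> P(f)\<close> and \<open>Q(f) \<circ> \<eta>\<^sub>V\<close> agree: for strict morphisms as polynomial maps of
\<open>f \<in> Hom(V, W)\<close>, for natural transformations as functions of \<open>f\<close>. Both expressions are
homogeneous of degree \<open>d\<close>, so it suffices that a homogeneous polynomial map of degree \<open>d\<close> between
finite-dimensional spaces is determined by its values when \<open>k\<close> has at least \<open>d\<close> elements. The two
spaces of morphisms then coincide as records, and the forgetful map is the identity of a vector space.

For a field with more than \<open>d\<close> elements the uniqueness is the usual one: every exponent is at most \<open>d\<close>,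
and a polynomial whose degree in each variable is below \<open>card k\<close> can be interpolated. The remaining
case is \<open>card k = q = d\<close>. There \<open>x\<^sup>q = x\<close> for all \<open>x \<in> k\<close>, and
the only monomials of degree \<open>q\<close> with an exponent that is not below \<open>q\<close> are the pure powers \<open>x\<^sub>i\<^sup>q\<close>.
As functions these are the monomials \<open>x\<^sub>i\<close> of degree one, and since \<open>q \<ge> 2\<close>, these differ from all the
other monomials of degree \<open>q\<close>. Hence distinct monomials of degree \<open>d\<close> still
have distinct reduced exponents, and interpolation on a grid extracts each coefficient
(\<open>homogeneous_monomials_dual_basis\<close>). In degree \<open>q + 1\<close> this fails: \<open>x\<^sup>q y - x y\<^sup>q\<close> vanishes everywhere.

Polynomial maps are given here by generators \<open>l\<^sub>1 \<cdots> l\<^sub>r \<otimes> w\<close> and relations, so the coefficients must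
first be made visible. Modulo the relations, every functional expands in a coordinate system of the source,
which gives a normal form (\<open>homogeneous_normal_form\<close>); the vectors that accompany one monomial combine
into a single coefficient vector (\<open>collect_vectors\<close>). If all values vanish, then all coefficient vectors
vanish, and the formal sum lies in the span of the relators
(\<open>homogeneous_eval_zero_imp_relator_span\<close>). Applied to the difference of representatives of the
two expressions, this shows that equality of polynomial maps can be tested pointwise
(\<open>pm_post_eq_iff_pointwise\<close>).\<close>

section \<open>Homogeneous monomials as functions\<close>

text \<open>The Lagrange polynomials \<open>L\<^sub>x\<close> of the nodes \<open>x \<in> S\<close> satisfy \<open>\<Sum>\<^sub>x x\<^sup>j L\<^sub>x = X\<^sup>j\<close> for \<open>j < card S\<close>, since both
sides have degree below \<open>card S\<close> and agree on \<open>S\<close>. Comparing the coefficients of \<open>X\<^sup>n\<close> shows that the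
coefficients of the \<open>L\<^sub>x\<close> are the weights sought.\<close>

lemma lagrange_coefficients:
  fixes S :: "'k::field set"
  assumes "finite S" and "n < card S"
  shows "\<exists>c. \<forall>j<card S. (\<Sum>x\<in>S. c x * x ^ j) = of_bool (j = n)"
proof -
  define L where "L x = (\<Prod>y\<in>S - {x}. [:- (y / (x - y)), 1 / (x - y):])" for x
  have L: "poly (L x) z = of_bool (z = x)" if "x \<in> S" "z \<in> S" for x z
  proof (cases "z = x")
    case True
    have "x / (x - y) - y / (x - y) = 1" if "y \<noteq> x" for y
      using that by (metis diff_divide_distrib divide_self right_minus_eq)
    then have "poly (L x) z = (\<Prod>y\<in>S - {x}. 1)"
      unfolding L_def poly_prod True
      by (intro prod.cong) auto
    then show ?thesis using True by simp
  next
    case False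
    then show ?thesis
      using that assms by (auto simp: L_def poly_prod intro!: prod_zero bexI[of _ z])
  qed
  have deg_L: "degree (L x) < card S" if "x \<in> S" for x
  proof -
    have "degree (L x) \<le> (\<Sum>y\<in>S - {x}. degree [:- (y / (x - y)), 1 / (x - y):])"
      unfolding L_def by (rule degree_prod_sum_le[unfolded o_def]) (use assms in auto)
    also have "\<dots> \<le> (\<Sum>y\<in>S - {x}. 1)"
      by (rule sum_mono) simp
    also have "\<dots> < card S"
      using that assms by (simp add: card_gt_0_iff)
    finally show ?thesis .
  qed
  have "(\<Sum>x\<in>S. coeff (L x) n * x ^ j) = of_bool (j = n)" if "j < card S" for j
  proof -
    have "(\<Sum>x\<in>S. Polynomial.smult (x ^ j) (L x)) = monom 1 j"
    proof (rule poly_eqI_degree[of S])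
      fix z assume "z \<in> S"
      then show "poly (\<Sum>x\<in>S. Polynomial.smult (x ^ j) (L x)) z = poly (monom 1 j) z"
        using assms by (simp add: poly_sum L poly_monom of_bool_def if_distrib cong: if_cong)
    next
      show "card S > degree (\<Sum>x\<in>S. Polynomial.smult (x ^ j) (L x))"
        using assms deg_L
        by (intro degree_sum_less) (auto intro: le_less_trans[OF degree_smult_le])
    qed (use that in \<open>simp_all add: degree_monom_eq\<close>)
    from arg_cong[OF this, of "\<lambda>p. coeff p n"] show ?thesis
      by (simp add: coeff_sum mult.commute[of _ "_ ^ j"] eq_commute[of n])
  qed
  then show ?thesis by (intro exI[of _ "\<lambda>x. coeff (L x) n"] allI impI)
qed

text \<open>The weight of a grid point is the product of the one-variable weights of its coordinates; the sum
over the grid then factors into one-variable sums.\<close>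

lemma monomial_coefficient_extraction:
  fixes S :: "'k::field set" and e :: "'i \<Rightarrow> nat"
  assumes "finite S" and "finite I" and "\<And>i. i \<in> I \<Longrightarrow> e i < card S"
  shows "\<exists>c. \<forall>e'. (\<forall>i\<in>I. e' i < card S) \<longrightarrow>
    (\<Sum>t\<in>Pi\<^sub>E I (\<lambda>_. S). c t * (\<Prod>i\<in>I. t i ^ e' i)) = of_bool (\<forall>i\<in>I. e' i = e i)"
proof -
  obtain c where c: "\<And>i j. i \<in> I \<Longrightarrow> j < card S \<Longrightarrow> (\<Sum>x\<in>S. c i x * x ^ j) = of_bool (j = e i)"
    using lagrange_coefficients[OF assms(1) assms(3)] by metis
  have "(\<Sum>t\<in>Pi\<^sub>E I (\<lambda>_. S). (\<Prod>i\<in>I. c i (t i)) * (\<Prod>i\<in>I. t i ^ e' i)) = of_bool (\<forall>i\<in>I. e' i = e i)"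
    if "\<forall>i\<in>I. e' i < card S" for e'
  proof -
    have "(\<Sum>t\<in>Pi\<^sub>E I (\<lambda>_. S). (\<Prod>i\<in>I. c i (t i)) * (\<Prod>i\<in>I. t i ^ e' i))
        = (\<Prod>i\<in>I. \<Sum>x\<in>S. c i x * x ^ e' i)"
      using assms by (simp add: prod.distrib prod_sum_PiE)
    also have "\<dots> = (\<Prod>i\<in>I. of_bool (e' i = e i))"
      using that c by (intro prod.cong) auto
    also have "\<dots> = of_bool (\<forall>i\<in>I. e' i = e i)"
      using assms(2) by (induction I) auto
    finally show ?thesis .
  qed
  then show ?thesis by (intro exI[of _ "\<lambda>t. \<Prod>i\<in>I. c i (t i)"]) auto
qed

text \<open>Multiplication by a nonzero \<open>x\<close> permutes the nonzero elements, so it does not change their product.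
Finiteness is a hypothesis here, and not a sort constraint on the field, because it holds only in one
branch of a case distinction below.\<close>

lemma power_card_UNIV_eq_self:
  fixes x :: "'k::field"
  assumes "finite (UNIV :: 'k set)"
  shows "x ^ card (UNIV :: 'k set) = x"
proof (cases "x = 0")
  case True
  then show ?thesis using assms by (simp add: card_gt_0_iff)
next
  case False
  let ?U = "UNIV - {0 :: 'k}"
  have "bij_betw ((*) x) ?U ?U"
    by (rule bij_betwI[of _ _ _ "\<lambda>y. y / x"]) (use False in auto)
  then have "(\<Prod>y\<in>?U. y) = (\<Prod>y\<in>?U. x * y)"
    by (rule prod.reindex_bij_betw[symmetric])
  also have "\<dots> = x ^ card ?U * (\<Prod>y\<in>?U. y)"
    by (simp add: prod.distrib)
  finally have "x ^ card ?U = 1"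
    using assms by auto
  moreover have "card (UNIV :: 'k set) = Suc (card ?U)"
    using card_Suc_Diff1[OF assms, of 0] by simp
  ultimately show ?thesis by (metis power_Suc mult.right_neutral)
qed

lemma size_eq_count_imp_replicate:
  assumes "count m l = size m"
  shows "m = replicate_mset (size m) l"
proof -
  have "replicate_mset (size m) l \<subseteq># m"
    using assms by (metis count_le_replicate_mset_subset_eq order_refl)
  then show ?thesis
    by (metis mset_subset_size nat_less_le size_replicate_mset subset_mset.order_iff_strict)
qed

text \<open>The least exponent that defines the same function as \<open>n\<close> on a field with \<open>q\<close> elements, in
the range that occurs below, \<open>n \<le> q\<close>.\<close>

definition reduced_exponent :: "nat \<Rightarrow> nat \<Rightarrow> nat" where
  "reduced_exponent q n = (if n = q then 1 else n)"

text \<open>An exponent is changed only if it equals \<open>q\<close>, which forces \<open>d = q\<close> and makes the monomial a pure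
power, with reduced degree \<open>1\<close>. A monomial in which no exponent equals \<open>q\<close> keeps its degree
\<open>q \<noteq> 1\<close>, so it cannot have the same reduced exponents.\<close>

lemma reduced_exponents_inject:
  assumes "size m = d" "size m' = d" "d \<le> q" "q \<ge> 2"
    and eq: "\<And>l. reduced_exponent q (count m l) = reduced_exponent q (count m' l)"
  shows "m = m'"
proof -
  have full: "m1 = m2"
    if m: "size m1 = d" "size m2 = d" "count m1 l = q"
      and eq: "\<And>l. reduced_exponent q (count m1 l) = reduced_exponent q (count m2 l)" for m1 m2 :: "'a multiset" and l
  proof -
    have d: "d = q"
      using m(1,3) assms(3) count_le_size[of m1 l] by simp
    have m1: "m1 = replicate_mset q l"
      using m d size_eq_count_imp_replicate[of m1 l] by simp
    have "count m2 l = q"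
    proof (rule ccontr)
      assume "count m2 l \<noteq> q"
      then have 1: "count m2 l = 1"
        using eq[of l] m(3) by (simp add: reduced_exponent_def)
      have "count m2 l' = 0" if "l' \<noteq> l" for l'
        using eq[of l'] that assms(4) m1 by (auto simp: reduced_exponent_def split: if_splits)
      then have "m2 = {#l#}"
        using 1 by (intro multiset_eqI) auto
      then show False
        using m(2) d assms(4) by simp
    qed
    then show ?thesis
      using m1 m d size_eq_count_imp_replicate[of m2 l] by simp
  qed
  show ?thesis
  proof (cases "\<exists>l. count m l = q \<or> count m' l = q")
    case True
    then show ?thesis
      using full[of m m'] full[of m' m] assms(1,2) eq by metis
  next
    case False
    then show ?thesis
      using eq by (intro multiset_eqI) (simp add: reduced_exponent_def)
  qed
qed

text \<open>On \<open>D\<close>-indexed tuples, the monomials of degree \<open>d\<close> are linearly independent functions, and the weights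
\<open>c\<close> form the functional dual to \<open>m\<close>. This is where the bound on \<open>d\<close> enters. A finite field is used in full as the
set of nodes, so that the case \<open>d = card k\<close> is covered by reducing exponents; in an infinite field, more
than \<open>d\<close> nodes are available and reduction changes nothing.\<close>

lemma homogeneous_monomials_dual_basis:
  fixes D :: "('v \<Rightarrow> 'k::field) set"
  assumes k: "infinite (UNIV :: 'k set) \<or> d \<le> card (UNIV :: 'k set)"
    and D: "finite D" and m: "size m = d" "set_mset m \<subseteq> D"
  shows "\<exists>(T :: (('v \<Rightarrow> 'k) \<Rightarrow> 'k) set) c. finite T \<and> (\<forall>m'. size m' = d \<longrightarrow> set_mset m' \<subseteq> D \<longrightarrow>
    (\<Sum>t\<in>T. c t * (\<Prod>l\<in>#m'. t l)) = of_bool (m' = m))"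
proof -
  obtain S :: "'k set" where S: "finite S" "card S \<ge> 2" "d \<le> card S"
    and pow: "\<And>x. d = card S \<Longrightarrow> x ^ card S = (x :: 'k)"
  proof (cases "finite (UNIV :: 'k set)")
    case True
    have "card {0, 1 :: 'k} \<le> card (UNIV :: 'k set)"
      using True by (intro card_mono) auto
    then show ?thesis
      using True k power_card_UNIV_eq_self by (intro that[of UNIV]) auto
  next
    case False
    then obtain S :: "'k set" where "finite S" "card S = d + 2"
      using infinite_arbitrarily_large by blast
    \<comment> \<open>The premise \<open>d = card S\<close> on the powers is false for this \<open>S\<close>.\<close>
    then show ?thesis by (intro that[of S]) auto
  qed
  let ?q = "card S"
  have bound: "reduced_exponent ?q (count m' l) < ?q" if "size m' = d" for m' :: "('v \<Rightarrow> 'k) multiset" and l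
    using that S count_le_size[of m' l] by (auto simp: reduced_exponent_def)
  have red: "x ^ count m' l = x ^ reduced_exponent ?q (count m' l)"
    if "size m' = d" for m' :: "('v \<Rightarrow> 'k) multiset" and l and x :: 'k
    using that S pow[of x] count_le_size[of m' l] by (auto simp: reduced_exponent_def)
  obtain c where c: "\<And>e'. (\<forall>l\<in>D. e' l < ?q) \<Longrightarrow>
      (\<Sum>t\<in>Pi\<^sub>E D (\<lambda>_. S). c t * (\<Prod>l\<in>D. t l ^ e' l))
        = of_bool (\<forall>l\<in>D. e' l = reduced_exponent ?q (count m l))"
    using monomial_coefficient_extraction[OF S(1) D, of "\<lambda>l. reduced_exponent ?q (count m l)"] bound[OF m(1)]
    by blast
  have "(\<Sum>t\<in>Pi\<^sub>E D (\<lambda>_. S). c t * (\<Prod>l\<in>#m'. t l)) = of_bool (m' = m)"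
    if m': "size m' = d" "set_mset m' \<subseteq> D" for m'
  proof -
    have "(\<Prod>l\<in>#m'. t l) = (\<Prod>l\<in>D. t l ^ reduced_exponent ?q (count m' l))"
      for t :: "('v \<Rightarrow> 'k) \<Rightarrow> 'k"
    proof -
      have "(\<Prod>l\<in>#m'. t l) = (\<Prod>l\<in>D. t l ^ count m' l)"
        unfolding image_prod_mset_multiplicity
        by (rule prod.mono_neutral_left) (use m' D in \<open>auto simp: not_in_iff\<close>)
      then show ?thesis
        by (simp only:) (intro prod.cong refl red m'(1))
    qed
    then have "(\<Sum>t\<in>Pi\<^sub>E D (\<lambda>_. S). c t * (\<Prod>l\<in>#m'. t l))
      = of_bool (\<forall>l\<in>D. reduced_exponent ?q (count m' l) = reduced_exponent ?q (count m l))"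
      using c bound[OF m'(1)] by simp
    also have "(\<forall>l\<in>D. reduced_exponent ?q (count m' l) = reduced_exponent ?q (count m l)) \<longleftrightarrow> m' = m"
    proof
      assume *: "\<forall>l\<in>D. reduced_exponent ?q (count m' l) = reduced_exponent ?q (count m l)"
      have "reduced_exponent ?q (count m' l) = reduced_exponent ?q (count m l)" for l
      proof (cases "l \<in> D")
        case False
        then have "count m' l = 0" "count m l = 0"
          using m m' by (auto simp: not_in_iff[symmetric])
        then show ?thesis by simp
      qed (use * in blast)
      then show "m' = m"
        using reduced_exponents_inject[OF m'(1) m(1) S(3,2)] by blast
    qed simp
    finally show ?thesis .
  qed
  then show ?thesis
    using S(1) D by (intro exI[of _ "Pi\<^sub>E D (\<lambda>_. S)"] exI[of _ c]) (auto intro: finite_PiE)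
qed

section \<open>Vector spaces and coordinates\<close>

text \<open>Vector spaces over the field \<open>'k\<close>, with the operations of the ring record rewritten to those of the
type class.\<close>

locale kspace =
  fixes V :: "('k::field, 'v) module" (structure)
  assumes vectorspace: "vectorspace class_ring V"

sublocale kspace \<subseteq> vectorspace class_ring V
  rewrites "carrier (class_ring :: 'k ring) = UNIV"
    and "mult (class_ring :: 'k ring) = (*)"
    and "add (class_ring :: 'k ring) = (+)"
    and "one (class_ring :: 'k ring) = 1"
    and "zero (class_ring :: 'k ring) = 0"
    and "a_inv (class_ring :: 'k ring) = uminus"
  using vectorspace by (simp_all add: class_ring_simps)

lemma kspaceI:
  fixes V :: "('k::field, 'v) module"
  assumes "\<zero>\<^bsub>V\<^esub> \<in> carrier V"
    and "\<And>v w. v \<in> carrier V \<Longrightarrow> w \<in> carrier V \<Longrightarrow> v \<oplus>\<^bsub>V\<^esub> w \<in> carrier V"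
    and "\<And>c v. v \<in> carrier V \<Longrightarrow> c \<odot>\<^bsub>V\<^esub> v \<in> carrier V"
    and "\<And>v w. v \<in> carrier V \<Longrightarrow> w \<in> carrier V \<Longrightarrow> v \<oplus>\<^bsub>V\<^esub> w = w \<oplus>\<^bsub>V\<^esub> v"
    and "\<And>v w x. v \<in> carrier V \<Longrightarrow> w \<in> carrier V \<Longrightarrow> x \<in> carrier V \<Longrightarrow>
      (v \<oplus>\<^bsub>V\<^esub> w) \<oplus>\<^bsub>V\<^esub> x = v \<oplus>\<^bsub>V\<^esub> (w \<oplus>\<^bsub>V\<^esub> x)"
    and "\<And>v. v \<in> carrier V \<Longrightarrow> v \<oplus>\<^bsub>V\<^esub> \<zero>\<^bsub>V\<^esub> = v"
    and "\<And>v. v \<in> carrier V \<Longrightarrow> v \<oplus>\<^bsub>V\<^esub> (- 1) \<odot>\<^bsub>V\<^esub> v = \<zero>\<^bsub>V\<^esub>"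
    and "\<And>a b v. v \<in> carrier V \<Longrightarrow> (a * b) \<odot>\<^bsub>V\<^esub> v = a \<odot>\<^bsub>V\<^esub> (b \<odot>\<^bsub>V\<^esub> v)"
    and "\<And>v. v \<in> carrier V \<Longrightarrow> 1 \<odot>\<^bsub>V\<^esub> v = v"
    and "\<And>a b v. v \<in> carrier V \<Longrightarrow> (a + b) \<odot>\<^bsub>V\<^esub> v = a \<odot>\<^bsub>V\<^esub> v \<oplus>\<^bsub>V\<^esub> b \<odot>\<^bsub>V\<^esub> v"
    and "\<And>a v w. v \<in> carrier V \<Longrightarrow> w \<in> carrier V \<Longrightarrow>
      a \<odot>\<^bsub>V\<^esub> (v \<oplus>\<^bsub>V\<^esub> w) = a \<odot>\<^bsub>V\<^esub> v \<oplus>\<^bsub>V\<^esub> a \<odot>\<^bsub>V\<^esub> w"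
  shows "kspace V"
proof (rule kspace.intro)
  have neg: "\<exists>w\<in>carrier V. v \<oplus>\<^bsub>V\<^esub> w = \<zero>\<^bsub>V\<^esub>" if "v \<in> carrier V" for v
    using assms(3,7) that by blast
  show "vectorspace class_ring V"
    by (rule vs_criteria) (use assms neg in \<open>auto intro: class_field\<close>)
qed

lemma (in kspace) add_neg_smult: "v \<in> carrier V \<Longrightarrow> v \<oplus> (- 1) \<odot> v = \<zero>"
  using smult_minus_1[of v] by (simp add: class_ring_simps M.r_neg)

lemma (in kspace) laws:
  shows "v \<in> carrier V \<Longrightarrow> w \<in> carrier V \<Longrightarrow> v \<oplus> w \<in> carrier V"
    and "v \<in> carrier V \<Longrightarrow> c \<odot> v \<in> carrier V"
    and "v \<in> carrier V \<Longrightarrow> w \<in> carrier V \<Longrightarrow> v \<oplus> w = w \<oplus> v"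
    and "v \<in> carrier V \<Longrightarrow> w \<in> carrier V \<Longrightarrow> x \<in> carrier V \<Longrightarrow>
      (v \<oplus> w) \<oplus> x = v \<oplus> (w \<oplus> x)"
    and "v \<in> carrier V \<Longrightarrow> v \<oplus> \<zero> = v"
    and "v \<in> carrier V \<Longrightarrow> v \<oplus> (- 1) \<odot> v = \<zero>"
    and "v \<in> carrier V \<Longrightarrow> (a * b) \<odot> v = a \<odot> (b \<odot> v)"
    and "v \<in> carrier V \<Longrightarrow> 1 \<odot> v = v"
    and "v \<in> carrier V \<Longrightarrow> (a + b) \<odot> v = a \<odot> v \<oplus> b \<odot> v"
    and "v \<in> carrier V \<Longrightarrow> w \<in> carrier V \<Longrightarrow> a \<odot> (v \<oplus> w) = a \<odot> v \<oplus> a \<odot> w"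
  by (simp_all add: M.a_ac smult_l_distr smult_r_distr smult_assoc1 add_neg_smult)

lemma mem_module_hom_iff:
  fixes V :: "('k::field, 'v) module" and W :: "('k, 'w) module"
  shows "f \<in> LinearCombinations.module_hom class_ring V W \<longleftrightarrow>
    f \<in> carrier V \<rightarrow> carrier W \<and>
    (\<forall>v\<in>carrier V. \<forall>v'\<in>carrier V. f (v \<oplus>\<^bsub>V\<^esub> v') = f v \<oplus>\<^bsub>W\<^esub> f v') \<and>
    (\<forall>c. \<forall>v\<in>carrier V. f (c \<odot>\<^bsub>V\<^esub> v) = c \<odot>\<^bsub>W\<^esub> f v)"
  by (auto simp: LinearCombinations.module_hom_def)

lemma module_hom_zero:
  fixes V :: "('k::field, 'v) module" and W :: "('k, 'w) module"
  assumes "kspace V" and "kspace W" and f: "f \<in> LinearCombinations.module_hom class_ring V W"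
  shows "f \<zero>\<^bsub>V\<^esub> = \<zero>\<^bsub>W\<^esub>"
proof -
  interpret V: kspace V by fact
  interpret W: kspace W by fact
  have "f (0 \<odot>\<^bsub>V\<^esub> \<zero>\<^bsub>V\<^esub>) = 0 \<odot>\<^bsub>W\<^esub> f \<zero>\<^bsub>V\<^esub>" and "f \<zero>\<^bsub>V\<^esub> \<in> carrier W"
    using f V.M.zero_closed unfolding mem_module_hom_iff by blast+
  then show ?thesis by simp
qed

lemma hom_space_simps [simp]:
  "f \<in> carrier (hom_space V W) \<longleftrightarrow>
    f \<in> LinearCombinations.module_hom class_ring V W \<and> f \<in> extensional (carrier V)"
  "\<zero>\<^bsub>hom_space V W\<^esub> = (\<lambda>x\<in>carrier V. \<zero>\<^bsub>W\<^esub>)"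
  "f \<oplus>\<^bsub>hom_space V W\<^esub> g = (\<lambda>x\<in>carrier V. f x \<oplus>\<^bsub>W\<^esub> g x)"
  "c \<odot>\<^bsub>hom_space V W\<^esub> f = (\<lambda>x\<in>carrier V. c \<odot>\<^bsub>W\<^esub> f x)"
  by (simp_all add: hom_space_def)

lemma kspace_hom_space:
  assumes "kspace V" and "kspace W"
  shows "kspace (hom_space V W)"
proof -
  interpret V: kspace V by fact
  interpret W: kspace W by fact
  show ?thesis
  proof (rule kspaceI, goal_cases)
    case 1
    show ?case by (simp add: mem_module_hom_iff)
  next
    case (2 f g)
    then show ?case
      by (auto simp: mem_module_hom_iff Pi_iff W.M.a_ac W.smult_r_distr)
  next
    case (3 c f)
    then show ?case
      by (auto simp: mem_module_hom_iff Pi_iff W.smult_r_distr W.smult_assoc1[symmetric] mult.commute)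
  qed (auto simp: mem_module_hom_iff Pi_iff fun_eq_iff extensional_def W.M.a_ac W.add_neg_smult
      W.smult_r_distr W.smult_l_distr W.smult_assoc1)
qed

lemma mem_dual_iff:
  "l \<in> carrier (dual V) \<longleftrightarrow> l \<in> extensional (carrier V) \<and>
    (\<forall>v\<in>carrier V. \<forall>v'\<in>carrier V. l (v \<oplus>\<^bsub>V\<^esub> v') = l v + l v') \<and>
    (\<forall>c. \<forall>v\<in>carrier V. l (c \<odot>\<^bsub>V\<^esub> v) = c * l v)"
  by (auto simp: dual_def base_space_def mem_module_hom_iff)

lemma dual_simps [simp]:
  "l \<oplus>\<^bsub>dual V\<^esub> l' = (\<lambda>v\<in>carrier V. l v + l' v)"
  "c \<odot>\<^bsub>dual V\<^esub> l = (\<lambda>v\<in>carrier V. c * l v)"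
  by (simp_all add: dual_def base_space_def)

lemma kspace_base_space: "kspace (base_space :: ('k::field, 'k) module)"
  by (rule kspaceI) (simp_all add: base_space_def algebra_simps)

lemma kspace_dual: "kspace V \<Longrightarrow> kspace (dual V)"
  unfolding dual_def by (intro kspace_hom_space kspace_base_space)

lemma (in kspace) dual_finsum:
  assumes "l \<in> carrier (dual V)" and "finite C" and "u \<in> C \<rightarrow> carrier V"
  shows "l (\<Oplus>b\<in>C. c b \<odot> u b) = (\<Sum>b\<in>C. c b * l (u b))"
  using assms(2,3)
proof (induction C)
  case empty
  have "l (0 \<odot> \<zero>) = 0 * l \<zero>"
    using assms(1) unfolding mem_dual_iff by blast
  then show ?case by simp
next
  case (insert b C)
  then show ?case
    using assms(1) by (simp add: mem_dual_iff Pi_iff finsum_insert)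
qed

text \<open>A finite set of functionals that identifies \<open>V\<close> with the space of all tuples indexed by \<open>D\<close>, in other
words a basis of the dual space. Vectors are constructed by prescribing their coordinates and compared by
their coordinates, which suits spaces of linear maps, where a basis is less direct to write down.\<close>

definition coordinates :: "('k::field, 'v) module \<Rightarrow> ('v \<Rightarrow> 'k) set \<Rightarrow> bool" where
  "coordinates V D \<longleftrightarrow> finite D \<and> D \<subseteq> carrier (dual V) \<and>
    (\<forall>t. \<exists>v\<in>carrier V. \<forall>l\<in>D. l v = t l) \<and>
    (\<forall>v\<in>carrier V. \<forall>v'\<in>carrier V. (\<forall>l\<in>D. l v = l v') \<longrightarrow> v = v')"

lemma fin_vec_kspace: "V \<in> fin_vec \<Longrightarrow> kspace V"
  by (simp add: fin_vec_def kspace_def)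

text \<open>The coordinate functions of a finite basis.\<close>

lemma coordinates_exist:
  fixes V :: "('k::field, 'v) module"
  assumes "V \<in> fin_vec"
  shows "\<exists>D. coordinates V D"
proof -
  interpret kspace V by (rule fin_vec_kspace) fact
  obtain B where B: "finite B" "basis B"
    using finite_basis_exists assms by (auto simp: fin_vec_def)
  then have BV: "B \<subseteq> carrier V"
    by (simp add: basis_def)
  have "\<forall>v\<in>carrier V. \<exists>!a. a \<in> B \<rightarrow>\<^sub>E UNIV \<and> lincomb a B = v"
    using basis_criterion[OF B(1) BV] B(2) by auto
  then obtain a where a: "\<And>v. v \<in> carrier V \<Longrightarrow> a v \<in> B \<rightarrow>\<^sub>E UNIV \<and> lincomb (a v) B = v"
    and uniq: "\<And>v c. v \<in> carrier V \<Longrightarrow> c \<in> B \<rightarrow>\<^sub>E UNIV \<Longrightarrow> lincomb c B = v \<Longrightarrow> c = a v"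
    by metis
  have a_eq: "a (lincomb c B) b = c b" if "b \<in> B" for c b
  proof -
    have "lincomb (restrict c B) B = lincomb c B"
      using BV by (intro lincomb_cong) auto
    then have "restrict c B = a (lincomb c B)"
      using BV by (intro uniq) auto
    then show ?thesis using that by (metis restrict_apply')
  qed
  have add: "a (v \<oplus>\<^bsub>V\<^esub> w) b = a v b + a w b" if "v \<in> carrier V" "w \<in> carrier V" "b \<in> B" for v w b
    using a_eq[of b "\<lambda>b. a v b + a w b"] lincomb_sum[OF B(1) BV, of "a v" "a w"] a that by simp
  have smult: "a (c \<odot>\<^bsub>V\<^esub> v) b = c * a v b" if "v \<in> carrier V" "b \<in> B" for c v b
    using a_eq[of b "\<lambda>b. c * a v b"] lincomb_smult[OF BV, of "a v" c] a that by simp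
  define x where "x b = (\<lambda>v\<in>carrier V. a v b)" for b
  have "coordinates V (x ` B)"
    unfolding coordinates_def
  proof (intro conjI allI ballI impI)
    show "finite (x ` B)" using B by simp
    show "x ` B \<subseteq> carrier (dual V)"
      by (auto simp: mem_dual_iff x_def add smult)
  next
    fix t :: "('v \<Rightarrow> 'k) \<Rightarrow> 'k"
    show "\<exists>v\<in>carrier V. \<forall>l\<in>x ` B. l v = t l"
      using BV by (intro bexI[of _ "lincomb (\<lambda>b. t (x b)) B"]) (auto simp: x_def a_eq)
  next
    fix v v' assume v: "v \<in> carrier V" "v' \<in> carrier V" and eq: "\<forall>l\<in>x ` B. l v = l v'"
    have "lincomb (a v) B = lincomb (a v') B"
      using BV eq v by (intro lincomb_cong) (auto simp: x_def)
    then show "v = v'" using a v by metis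
  qed
  then show ?thesis by blast
qed

text \<open>Both sides agree because \<open>v\<close> and \<open>\<Sum> b(v) e\<^sub>b\<close> have the same coordinates.\<close>

lemma dual_eq_coordinate_sum:
  assumes "kspace V" and "coordinates V D" and e: "\<And>b. b \<in> D \<Longrightarrow> e b \<in> carrier V"
    "\<And>b b'. b \<in> D \<Longrightarrow> b' \<in> D \<Longrightarrow> b' (e b) = of_bool (b' = b)"
    and l: "l \<in> carrier (dual V)"
  shows "l = (\<lambda>v\<in>carrier V. \<Sum>b\<in>D. l (e b) * b v)"
proof
  interpret kspace V by fact
  have D: "finite D" "D \<subseteq> carrier (dual V)"
    and inj: "\<And>v v'. v \<in> carrier V \<Longrightarrow> v' \<in> carrier V \<Longrightarrow> \<forall>b\<in>D. b v = b v' \<Longrightarrow> v = v'"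
    using assms(2) unfolding coordinates_def by auto
  fix v
  show "l v = (\<lambda>v\<in>carrier V. \<Sum>b\<in>D. l (e b) * b v) v"
  proof (cases "v \<in> carrier V")
    case True
    have "(\<Oplus>\<^bsub>V\<^esub>b\<in>D. b v \<odot>\<^bsub>V\<^esub> e b) = v"
    proof (rule inj)
      show "(\<Oplus>\<^bsub>V\<^esub>b\<in>D. b v \<odot>\<^bsub>V\<^esub> e b) \<in> carrier V"
        using e by (intro M.finsum_closed) auto
      show "\<forall>b\<in>D. b (\<Oplus>\<^bsub>V\<^esub>b\<in>D. b v \<odot>\<^bsub>V\<^esub> e b) = b v"
      proof
        fix b assume b: "b \<in> D"
        have "b (\<Oplus>\<^bsub>V\<^esub>b\<in>D. b v \<odot>\<^bsub>V\<^esub> e b) = (\<Sum>b'\<in>D. b' v * b (e b'))"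
          by (rule dual_finsum) (use b D e in auto)
        also have "\<dots> = (\<Sum>b'\<in>D. if b = b' then b' v else 0)"
          using e(2)[OF _ b] by (intro sum.cong) auto
        finally show "b (\<Oplus>\<^bsub>V\<^esub>b\<in>D. b v \<odot>\<^bsub>V\<^esub> e b) = b v"
          using b D by simp
      qed
    qed fact
    moreover have "l (\<Oplus>\<^bsub>V\<^esub>b\<in>D. b v \<odot>\<^bsub>V\<^esub> e b) = (\<Sum>b\<in>D. b v * l (e b))"
      by (rule dual_finsum) (use l D e in auto)
    ultimately show ?thesis using True by (simp add: mult.commute)
  next
    case False
    then show ?thesis using l by (simp add: mem_dual_iff extensional_def)
  qed
qed

lemma coordinates_dual_basis:
  assumes "coordinates V D"
  shows "\<exists>e. (\<forall>b\<in>D. e b \<in> carrier V) \<and> (\<forall>b\<in>D. \<forall>b'\<in>D. b' (e b) = of_bool (b' = b))"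
proof -
  have "\<forall>b. \<exists>v\<in>carrier V. \<forall>b'\<in>D. b' v = of_bool (b' = b)"
    using assms unfolding coordinates_def by simp
  from choice[OF this[unfolded Bex_def]] show ?thesis by blast
qed

text \<open>The coordinates of \<open>f\<close> are the matrix entries \<open>y(f(e\<^sub>b))\<close>. A linear map with prescribed entries is
obtained by prescribing the coordinates of all its values; linearity follows because
coordinates separate points.\<close>

lemma coordinates_hom_space:
  fixes V :: "('k::field, 'v) module" and W :: "('k, 'w) module"
  assumes "kspace V" and "kspace W" and D: "coordinates V D" and E: "coordinates W E"
  shows "\<exists>F. coordinates (hom_space V W) F"
proof -
  interpret V: kspace V by fact
  interpret W: kspace W by fact
  interpret H: kspace "hom_space V W" by (rule kspace_hom_space) fact+
  have finD: "finite D" and D_dual: "D \<subseteq> carrier (dual V)"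
    using D by (auto simp: coordinates_def)
  have finE: "finite E" and E_dual: "E \<subseteq> carrier (dual W)"
    and E_real: "\<And>t. \<exists>w\<in>carrier W. \<forall>y\<in>E. y w = t y"
    and E_inj: "\<And>w w'. w \<in> carrier W \<Longrightarrow> w' \<in> carrier W \<Longrightarrow> (\<And>y. y \<in> E \<Longrightarrow> y w = y w') \<Longrightarrow> w = w'"
    using E by (auto simp: coordinates_def)
  obtain e where e: "\<And>b. b \<in> D \<Longrightarrow> e b \<in> carrier V"
    "\<And>b b'. b \<in> D \<Longrightarrow> b' \<in> D \<Longrightarrow> b' (e b) = of_bool (b' = b)"
    using coordinates_dual_basis[OF D] by metis
  define z where "z b y = (\<lambda>f\<in>carrier (hom_space V W). y (f (e b)))" for b and y :: "'w \<Rightarrow> 'k"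
  let ?F = "(\<lambda>(b, y). z b y) ` (D \<times> E)"
  have "coordinates (hom_space V W) ?F"
    unfolding coordinates_def
  proof (intro conjI allI ballI impI)
    show "finite ?F" using finD finE by simp
    have "z b y \<in> carrier (dual (hom_space V W))" if "b \<in> D" "y \<in> E" for b y
    proof -
      have y: "y \<in> carrier (dual W)" using that E_dual by auto
      have im: "f (e b) \<in> carrier W" if "f \<in> carrier (hom_space V W)" for f
        using that e(1)[OF \<open>b \<in> D\<close>] by (auto simp: mem_module_hom_iff)
      show ?thesis
        unfolding mem_dual_iff
      proof (intro conjI ballI allI)
        fix f g assume fg: "f \<in> carrier (hom_space V W)" "g \<in> carrier (hom_space V W)"
        then have "f \<oplus>\<^bsub>hom_space V W\<^esub> g \<in> carrier (hom_space V W)"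
          by (rule H.M.a_closed)
        then show "z b y (f \<oplus>\<^bsub>hom_space V W\<^esub> g) = z b y f + z b y g"
          using fg im[OF fg(1)] im[OF fg(2)] y e(1)[OF \<open>b \<in> D\<close>]
          by (simp add: z_def mem_dual_iff del: hom_space_simps(1))
      next
        fix c f assume f: "f \<in> carrier (hom_space V W)"
        then have "c \<odot>\<^bsub>hom_space V W\<^esub> f \<in> carrier (hom_space V W)"
          using H.smult_closed by blast
        then show "z b y (c \<odot>\<^bsub>hom_space V W\<^esub> f) = c * z b y f"
          using f im[OF f] y e(1)[OF \<open>b \<in> D\<close>]
          by (simp add: z_def mem_dual_iff del: hom_space_simps(1))
      qed (simp add: z_def)
    qed
    then show "?F \<subseteq> carrier (dual (hom_space V W))" by auto
  next
    fix t :: "(('v \<Rightarrow> 'w) \<Rightarrow> 'k) \<Rightarrow> 'k"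
    have "\<forall>v. \<exists>w. w \<in> carrier W \<and> (\<forall>y\<in>E. y w = (\<Sum>b\<in>D. t (z b y) * b v))"
      by (intro allI) (rule E_real[unfolded Bex_def])
    then have "\<exists>g. \<forall>v. g v \<in> carrier W \<and> (\<forall>y\<in>E. y (g v) = (\<Sum>b\<in>D. t (z b y) * b v))"
      by (rule choice)
    then obtain g where g: "\<And>v. g v \<in> carrier W"
      "\<And>v y. y \<in> E \<Longrightarrow> y (g v) = (\<Sum>b\<in>D. t (z b y) * b v)"
      by auto
    have lin: "b (v \<oplus>\<^bsub>V\<^esub> v') = b v + b v'" "b (c \<odot>\<^bsub>V\<^esub> v) = c * b v"
      if "b \<in> D" "v \<in> carrier V" "v' \<in> carrier V" for b v v' c
      using that D_dual by (auto simp: mem_dual_iff)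
    have linE: "y (v \<oplus>\<^bsub>W\<^esub> v') = y v + y v'" "y (c \<odot>\<^bsub>W\<^esub> v) = c * y v"
      if "y \<in> E" "v \<in> carrier W" "v' \<in> carrier W" for y v v' c
      using that E_dual by (auto simp: mem_dual_iff)
    define f where "f = (\<lambda>v\<in>carrier V. g v)"
    have f: "f \<in> carrier (hom_space V W)"
      unfolding hom_space_simps mem_module_hom_iff
    proof (intro conjI ballI allI)
      fix v v' assume v: "v \<in> carrier V" "v' \<in> carrier V"
      have "g (v \<oplus>\<^bsub>V\<^esub> v') = g v \<oplus>\<^bsub>W\<^esub> g v'"
      proof (rule E_inj)
        fix y assume y: "y \<in> E"
        have "y (g (v \<oplus>\<^bsub>V\<^esub> v')) = (\<Sum>b\<in>D. t (z b y) * b v + t (z b y) * b v')"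
          unfolding g(2)[OF y] by (intro sum.cong) (auto dest!: lin(1)[OF _ v] simp: distrib_left)
        also have "\<dots> = y (g v \<oplus>\<^bsub>W\<^esub> g v')"
          by (simp add: linE(1)[OF y g(1) g(1)] g(2)[OF y] sum.distrib)
        finally show "y (g (v \<oplus>\<^bsub>V\<^esub> v')) = y (g v \<oplus>\<^bsub>W\<^esub> g v')" .
      qed (simp_all add: g(1))
      then show "f (v \<oplus>\<^bsub>V\<^esub> v') = f v \<oplus>\<^bsub>W\<^esub> f v'"
        using v by (simp add: f_def)
    next
      fix c v assume v: "v \<in> carrier V"
      have "g (c \<odot>\<^bsub>V\<^esub> v) = c \<odot>\<^bsub>W\<^esub> g v"
      proof (rule E_inj)
        fix y assume y: "y \<in> E"
        have "y (g (c \<odot>\<^bsub>V\<^esub> v)) = (\<Sum>b\<in>D. c * (t (z b y) * b v))"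
          unfolding g(2)[OF y] by (intro sum.cong) (auto dest!: lin(2)[OF _ v v])
        also have "\<dots> = y (c \<odot>\<^bsub>W\<^esub> g v)"
          by (simp add: linE(2)[OF y g(1) g(1)] g(2)[OF y] sum_distrib_left)
        finally show "y (g (c \<odot>\<^bsub>V\<^esub> v)) = y (c \<odot>\<^bsub>W\<^esub> g v)" .
      qed (simp_all add: g(1))
      then show "f (c \<odot>\<^bsub>V\<^esub> v) = c \<odot>\<^bsub>W\<^esub> f v"
        using v by (simp add: f_def)
    qed (auto simp: f_def g(1))
    moreover have "z b y f = t (z b y)" if "b \<in> D" "y \<in> E" for b y
    proof -
      have "z b y f = (\<Sum>b'\<in>D. t (z b' y) * b' (e b))"
        using f that(1) e(1) g(2)[OF that(2)] by (simp add: z_def f_def del: hom_space_simps(1))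
      also have "\<dots> = (\<Sum>b'\<in>D. if b = b' then t (z b' y) else 0)"
        by (intro sum.cong) (auto dest!: e(2)[OF that(1)])
      finally show ?thesis using that finD by simp
    qed
    ultimately show "\<exists>f\<in>carrier (hom_space V W). \<forall>l\<in>?F. l f = t l"
      by (intro bexI[of _ f]) auto
  next
    fix f g assume fg: "f \<in> carrier (hom_space V W)" "g \<in> carrier (hom_space V W)"
      and eq: "\<forall>l\<in>?F. l f = l g"
    show "f = g"
    proof
      fix v
      show "f v = g v"
      proof (cases "v \<in> carrier V")
        case True
        show ?thesis
        proof (rule E_inj)
          show "f v \<in> carrier W" "g v \<in> carrier W"
            using fg True by (auto simp: mem_module_hom_iff)
          fix y assume y: "y \<in> E"
          have pull: "(\<lambda>v\<in>carrier V. y (h v)) \<in> carrier (dual V)" if "h \<in> carrier (hom_space V W)" for h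
            using that y E_dual by (auto simp: mem_dual_iff mem_module_hom_iff Pi_iff)
          have "y (f (e b)) = y (g (e b))" if "b \<in> D" for b
          proof -
            have "z b y f = z b y g" using eq that y by auto
            then show ?thesis using fg by (simp add: z_def)
          qed
          then have same_sum: "(\<Sum>b\<in>D. y (f (e b)) * b v) = (\<Sum>b\<in>D. y (g (e b)) * b v)"
            by simp
          have expand: "y (h v) = (\<Sum>b\<in>D. y (h (e b)) * b v)" if "h \<in> carrier (hom_space V W)" for h
          proof -
            have "(\<lambda>v\<in>carrier V. y (h v)) v
                = (\<lambda>v\<in>carrier V. \<Sum>b\<in>D. (\<lambda>v\<in>carrier V. y (h v)) (e b) * b v) v"
              by (rule fun_cong[OF dual_eq_coordinate_sum[OF assms(1) D e pull[OF that]]])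
            also have "\<dots> = (\<Sum>b\<in>D. y (h (e b)) * b v)"
              unfolding restrict_apply'[OF True] by (intro sum.cong refl) (simp only: restrict_apply'[OF e(1)])
            finally show ?thesis unfolding restrict_apply'[OF True] .
          qed
          show "y (f v) = y (g v)"
            unfolding expand[OF fg(1)] expand[OF fg(2)] by (rule same_sum)
        qed
      next
        case False
        then show ?thesis using fg by (simp add: extensional_def)
      qed
    qed
  qed
  then show ?thesis by blast
qed

lemma compose_post_module_hom:
  fixes A :: "('k::field, 'w) module" and B :: "('k, 'x) module" and C :: "('k, 'u) module"
  assumes "g \<in> LinearCombinations.module_hom class_ring B C" and "kspace A"
  shows "compose (carrier A) g \<in> LinearCombinations.module_hom class_ring (hom_space A B) (hom_space A C)"
proof -
  interpret A: kspace A by fact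
  show ?thesis
    using assms(1) by (auto simp: mem_module_hom_iff compose_def Pi_iff fun_eq_iff)
qed

lemma compose_pre_module_hom:
  fixes A :: "('k::field, 'w) module" and B :: "('k, 'x) module" and C :: "('k, 'u) module"
  assumes "g \<in> LinearCombinations.module_hom class_ring A B" and "kspace A"
  shows "(\<lambda>\<psi>. compose (carrier A) \<psi> g) \<in> LinearCombinations.module_hom class_ring (hom_space B C) (hom_space A C)"
proof -
  interpret A: kspace A by fact
  show ?thesis
    using assms(1) by (auto simp: mem_module_hom_iff compose_def Pi_iff fun_eq_iff)
qed

section \<open>Formal polynomial maps and their values\<close>

lemma lookup_map_times [simp]:
  "Poly_Mapping.lookup (Poly_Mapping.map ((*) (c :: 'k::field)) a) x = c * Poly_Mapping.lookup a x"
  by (simp add: Poly_Mapping.map.rep_eq when_def)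

lemma map_times_add: "Poly_Mapping.map ((*) (c :: 'k::field)) (a + b)
    = Poly_Mapping.map ((*) c) a + Poly_Mapping.map ((*) c) b"
  by (rule poly_mapping_eqI) (simp add: lookup_add distrib_left)

lemma map_times_diff: "Poly_Mapping.map ((*) (c :: 'k::field)) (a - b)
    = Poly_Mapping.map ((*) c) a - Poly_Mapping.map ((*) c) b"
  by (rule poly_mapping_eqI) (simp add: lookup_minus right_diff_distrib)

lemma map_times_map_times: "Poly_Mapping.map ((*) (c :: 'k::field)) (Poly_Mapping.map ((*) e) a)
    = Poly_Mapping.map ((*) (c * e)) a"
  by (rule poly_mapping_eqI) simp

lemma map_times_zero [simp]: "Poly_Mapping.map ((*) (c :: 'k::field)) 0 = 0"
  by (rule poly_mapping_eqI) simp

lemma map_times_minus_one: "Poly_Mapping.map ((*) (- 1 :: 'k::field)) a = - a"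
  by (rule poly_mapping_eqI) simp

lemma sum_single_lookup: "(\<Sum>x\<in>Poly_Mapping.keys a. Poly_Mapping.single x (Poly_Mapping.lookup a x)) = a"
  by (rule poly_mapping_eqI)
    (simp add: lookup_sum lookup_single when_def in_keys_iff sum.delta if_distrib cong: if_cong)

lemma mem_formals_iff:
  "a \<in> formals V W \<longleftrightarrow> (\<forall>m w. Poly_Mapping.lookup a (m, w) \<noteq> 0 \<longrightarrow>
    set_mset m \<subseteq> carrier (dual V) \<and> w \<in> carrier W)"
  by (auto simp: formals_def in_keys_iff)

lemma formals_closed [intro]:
  fixes a b :: "('k::field, 'v, 'w) formal"
  shows formals_zero: "0 \<in> formals V W"
    and formals_add: "a \<in> formals V W \<Longrightarrow> b \<in> formals V W \<Longrightarrow> a + b \<in> formals V W"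
    and formals_diff: "a \<in> formals V W \<Longrightarrow> b \<in> formals V W \<Longrightarrow> a - b \<in> formals V W"
    and formals_scale: "a \<in> formals V W \<Longrightarrow> Poly_Mapping.map ((*) c) a \<in> formals V W"
    and formals_single: "set_mset m \<subseteq> carrier (dual V) \<Longrightarrow> w \<in> carrier W \<Longrightarrow>
      Poly_Mapping.single (m, w) c \<in> formals V W"
  unfolding mem_formals_iff lookup_add lookup_minus lookup_map_times lookup_single when_def
  by (simp, (metis add.right_neutral add.left_neutral), (metis diff_zero diff_0_right), (metis mult_zero_right), auto)

lemma formals_induct [consumes 1, case_names zero add]:
  fixes a :: "('k::field, 'v, 'w) formal"
  assumes "a \<in> formals V W" and "P 0"
    and "\<And>m w c b. set_mset m \<subseteq> carrier (dual V) \<Longrightarrow> w \<in> carrier W \<Longrightarrow> b \<in> formals V W \<Longrightarrow> P b \<Longrightarrow>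
      P (Poly_Mapping.single (m, w) c + b)"
  shows "P a"
proof -
  let ?s = "\<lambda>K. \<Sum>x\<in>K. Poly_Mapping.single x (Poly_Mapping.lookup a x)"
  have "K \<subseteq> Poly_Mapping.keys a \<Longrightarrow> ?s K \<in> formals V W \<and> P (?s K)" if "finite K" for K
    using that
  proof (induction K)
    case empty
    then show ?case using assms(2) by (simp add: formals_zero)
  next
    case (insert x K)
    obtain m w where x: "x = (m, w)" by (cases x)
    have "set_mset m \<subseteq> carrier (dual V)" "w \<in> carrier W"
      using assms(1) insert.prems x by (auto simp: formals_def)
    then show ?case
      using insert assms(3) by (auto simp: x)
  qed
  from this[of "Poly_Mapping.keys a"] show ?thesis
    by (simp add: sum_single_lookup)
qed

text \<open>The linear map on formal polynomial maps that sends \<open>m \<otimes> w\<close> to \<open>\<chi>(m) w\<close>. It covers evaluation at a point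
and, with \<open>\<chi>\<close> the indicator of one monomial, the extraction of a coefficient, so that a
linear relation between such weights gives a linear relation between values and coefficients.\<close>

definition weighted_sum :: "('k::field, 'w) module \<Rightarrow> (('v \<Rightarrow> 'k) multiset \<Rightarrow> 'k) \<Rightarrow>
    ('k, 'v, 'w) formal \<Rightarrow> 'w" where
  "weighted_sum W \<chi> a = (\<Oplus>\<^bsub>W\<^esub>x\<in>Poly_Mapping.keys a. (Poly_Mapping.lookup a x * \<chi> (fst x)) \<odot>\<^bsub>W\<^esub> snd x)"

lemma formal_eval_eq_weighted_sum: "formal_eval W v = weighted_sum W (\<lambda>m. \<Prod>l\<in>#m. l v)"
  by (simp add: formal_eval_def weighted_sum_def fun_eq_iff)

context
  fixes V :: "('k::field, 'v) module" and W :: "('k, 'w) module"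
  assumes W: "kspace W"
begin

interpretation W: kspace W by (rule W)

lemma weighted_sum_superset:
  assumes "a \<in> formals V W" and "finite A" and "Poly_Mapping.keys a \<subseteq> A" and "snd ` A \<subseteq> carrier W"
  shows "weighted_sum W \<chi> a = (\<Oplus>\<^bsub>W\<^esub>x\<in>A. (Poly_Mapping.lookup a x * \<chi> (fst x)) \<odot>\<^bsub>W\<^esub> snd x)"
  unfolding weighted_sum_def
  by (rule W.M.add.finprod_mono_neutral_cong_left) (use assms in \<open>auto simp: in_keys_iff image_subset_iff\<close>)

lemma snd_keys_formals: "a \<in> formals V W \<Longrightarrow> snd ` Poly_Mapping.keys a \<subseteq> carrier W"
  by (auto simp: formals_def)

lemma weighted_sum_closed: "a \<in> formals V W \<Longrightarrow> weighted_sum W \<chi> a \<in> carrier W"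
  unfolding weighted_sum_def
  by (intro W.M.finsum_closed) (auto simp: formals_def)

lemma weighted_sum_add:
  assumes a: "a \<in> formals V W" and b: "b \<in> formals V W"
  shows "weighted_sum W \<chi> (a + b) = weighted_sum W \<chi> a \<oplus>\<^bsub>W\<^esub> weighted_sum W \<chi> b"
proof -
  let ?A = "Poly_Mapping.keys a \<union> Poly_Mapping.keys b"
  have A: "finite ?A" "snd ` ?A \<subseteq> carrier W"
    using snd_keys_formals[OF a] snd_keys_formals[OF b] by auto
  have "weighted_sum W \<chi> (a + b) = (\<Oplus>\<^bsub>W\<^esub>x\<in>?A. (Poly_Mapping.lookup (a + b) x * \<chi> (fst x)) \<odot>\<^bsub>W\<^esub> snd x)"
    by (rule weighted_sum_superset[OF formals_add[OF a b]]) (use A keys_add[of a b] in auto)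
  also have "\<dots> = (\<Oplus>\<^bsub>W\<^esub>x\<in>?A. (Poly_Mapping.lookup a x * \<chi> (fst x)) \<odot>\<^bsub>W\<^esub> snd x
      \<oplus>\<^bsub>W\<^esub> (Poly_Mapping.lookup b x * \<chi> (fst x)) \<odot>\<^bsub>W\<^esub> snd x)"
    using A(2) by (intro W.M.finsum_cong') (auto simp: lookup_add distrib_right W.smult_l_distr image_subset_iff)
  also have "\<dots> = (\<Oplus>\<^bsub>W\<^esub>x\<in>?A. (Poly_Mapping.lookup a x * \<chi> (fst x)) \<odot>\<^bsub>W\<^esub> snd x)
      \<oplus>\<^bsub>W\<^esub> (\<Oplus>\<^bsub>W\<^esub>x\<in>?A. (Poly_Mapping.lookup b x * \<chi> (fst x)) \<odot>\<^bsub>W\<^esub> snd x)"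
    using A by (intro W.M.finsum_addf) (auto simp: image_subset_iff)
  also have "\<dots> = weighted_sum W \<chi> a \<oplus>\<^bsub>W\<^esub> weighted_sum W \<chi> b"
    using A weighted_sum_superset[OF a A(1) _ A(2)] weighted_sum_superset[OF b A(1) _ A(2)] by simp
  finally show ?thesis .
qed

lemma weighted_sum_zero: "weighted_sum W \<chi> (0 :: ('k, 'v, 'w) formal) = \<zero>\<^bsub>W\<^esub>"
  by (simp add: weighted_sum_def)

lemma weighted_sum_single:
  fixes m :: "('v \<Rightarrow> 'k) multiset"
  assumes "w \<in> carrier W"
  shows "weighted_sum W \<chi> (Poly_Mapping.single (m, w) c) = (c * \<chi> m) \<odot>\<^bsub>W\<^esub> w"
  using assms by (cases "c = 0") (simp_all add: weighted_sum_def)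

lemma weighted_sum_scale:
  assumes "a \<in> formals V W"
  shows "weighted_sum W \<chi> (Poly_Mapping.map ((*) c) a) = c \<odot>\<^bsub>W\<^esub> weighted_sum W \<chi> a"
  using assms
proof (induction rule: formals_induct)
  case zero
  then show ?case by (simp add: weighted_sum_zero)
next
  case (add m w e b)
  have "Poly_Mapping.map ((*) c) (Poly_Mapping.single (m, w) e) = Poly_Mapping.single (m, w) (c * e)"
    by (rule poly_mapping_eqI) (simp add: lookup_single when_def)
  then have "Poly_Mapping.map ((*) c) (Poly_Mapping.single (m, w) e + b)
      = Poly_Mapping.single (m, w) (c * e) + Poly_Mapping.map ((*) c) b"
    by (simp only: map_times_add)
  then show ?case
    using add by (simp add: weighted_sum_add formals_single formals_scale weighted_sum_single
        weighted_sum_closed W.smult_r_distr W.smult_assoc1 mult.assoc)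
qed

lemma weighted_sum_diff_eq_zero_iff:
  assumes a: "a \<in> formals V W" and b: "b \<in> formals V W"
  shows "weighted_sum W \<chi> (a - b) = \<zero>\<^bsub>W\<^esub> \<longleftrightarrow> weighted_sum W \<chi> a = weighted_sum W \<chi> b"
proof -
  have "weighted_sum W \<chi> a = weighted_sum W \<chi> (a - b) \<oplus>\<^bsub>W\<^esub> weighted_sum W \<chi> b"
    using weighted_sum_add[OF formals_diff[OF a b] b, of \<chi>] by simp
  then show ?thesis
    by (simp add: weighted_sum_closed[OF formals_diff[OF a b]] weighted_sum_closed[OF b])
qed

text \<open>A weighted sum is also linear in the weight.\<close>

lemma weighted_sum_weights_vanish:
  assumes a: "a \<in> formals V W" and "finite T"
    and "\<And>t. t \<in> T \<Longrightarrow> weighted_sum W (\<chi> t) a = \<zero>\<^bsub>W\<^esub>"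
  shows "weighted_sum W (\<lambda>m. \<Sum>t\<in>T. c t * \<chi> t m) a = \<zero>\<^bsub>W\<^esub>"
  using assms(2,3)
proof (induction T)
  case empty
  have "weighted_sum W (\<lambda>m. 0) a = (\<Oplus>\<^bsub>W\<^esub>x\<in>Poly_Mapping.keys a. \<zero>\<^bsub>W\<^esub>)"
    unfolding weighted_sum_def using snd_keys_formals[OF a]
    by (intro W.M.finsum_cong') (auto simp: image_subset_iff)
  then show ?case by simp
next
  case (insert t T)
  let ?K = "Poly_Mapping.keys a" and ?l = "Poly_Mapping.lookup a"
  have im: "snd x \<in> carrier W" if "x \<in> ?K" for x
    using snd_keys_formals[OF a] that by auto
  let ?\<xi> = "\<lambda>m. \<Sum>t\<in>T. c t * \<chi> t m"
  have "weighted_sum W (\<lambda>m. \<Sum>t\<in>insert t T. c t * \<chi> t m) a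
      = (\<Oplus>\<^bsub>W\<^esub>x\<in>?K. c t \<odot>\<^bsub>W\<^esub> ((?l x * \<chi> t (fst x)) \<odot>\<^bsub>W\<^esub> snd x) \<oplus>\<^bsub>W\<^esub> (?l x * ?\<xi> (fst x)) \<odot>\<^bsub>W\<^esub> snd x)"
    unfolding weighted_sum_def using insert.hyps
    by (intro W.M.finsum_cong')
      (auto simp: im distrib_left W.smult_l_distr W.smult_assoc1[symmetric] mult.left_commute)
  also have "\<dots> = (\<Oplus>\<^bsub>W\<^esub>x\<in>?K. c t \<odot>\<^bsub>W\<^esub> ((?l x * \<chi> t (fst x)) \<odot>\<^bsub>W\<^esub> snd x)) \<oplus>\<^bsub>W\<^esub> weighted_sum W ?\<xi> a"
    unfolding weighted_sum_def by (intro W.M.finsum_addf) (auto simp: im)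
  also have "(\<Oplus>\<^bsub>W\<^esub>x\<in>?K. c t \<odot>\<^bsub>W\<^esub> ((?l x * \<chi> t (fst x)) \<odot>\<^bsub>W\<^esub> snd x)) = c t \<odot>\<^bsub>W\<^esub> weighted_sum W (\<chi> t) a"
    unfolding weighted_sum_def by (intro W.finsum_smult_ldistr[symmetric]) (auto simp: im)
  finally show ?case
    using insert by simp
qed

lemma relators_subset_formals:
  assumes "kspace V"
  shows "relators V W \<subseteq> formals V W"
proof
  interpret D: kspace "dual V" by (rule kspace_dual) fact
  fix r assume "r \<in> relators V W"
  then show "r \<in> formals V W"
  proof cases
    case (add_functional m l l' w)
    then show ?thesis
      using D.M.a_closed[of l l'] by (auto intro!: formals_diff formals_single simp del: dual_simps)
  next
    case (smult_functional m l w c)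
    then show ?thesis
      using D.smult_closed[of c l] by (auto intro!: formals_diff formals_single simp del: dual_simps)
  qed (auto intro!: formals_diff formals_single)
qed

lemma formal_eval_relator_span:
  assumes "kspace V" and v: "v \<in> carrier V" and "a \<in> relator_span V W"
  shows "formal_eval W v a = \<zero>\<^bsub>W\<^esub>"
proof -
  interpret D: kspace "dual V" by (rule kspace_dual) fact
  let ?e = "weighted_sum W (\<lambda>m. \<Prod>l\<in>#m. l v)"
  have relator: "?e r = \<zero>\<^bsub>W\<^esub>" if "r \<in> relators V W" for r
    using that
  proof cases
    case (add_functional m l l' w)
    then have "l \<oplus>\<^bsub>dual V\<^esub> l' \<in> carrier (dual V)" by blast
    with add_functional show ?thesis
      using v
      by (subst add_functional(1), subst diff_diff_eq, subst weighted_sum_diff_eq_zero_iff)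
        (auto simp: weighted_sum_add formals_single weighted_sum_single distrib_right W.smult_l_distr simp del: dual_simps(2)
          intro!: formals_add formals_single)
  next
    case (smult_functional m l w c)
    then have "c \<odot>\<^bsub>dual V\<^esub> l \<in> carrier (dual V)" by blast
    with smult_functional show ?thesis
      using v by (subst smult_functional(1), subst weighted_sum_diff_eq_zero_iff)
        (auto simp: formals_single weighted_sum_single mult.assoc intro!: formals_single)
  next
    case (add_vector m w w')
    then show ?thesis
      by (subst add_vector(1), subst diff_diff_eq, subst weighted_sum_diff_eq_zero_iff)
        (auto simp: weighted_sum_add formals_single weighted_sum_single W.smult_r_distr intro!: formals_add formals_single)
  next
    case (smult_vector m w c)
    then show ?thesis
      by (subst smult_vector(1), subst weighted_sum_diff_eq_zero_iff)
        (auto simp: formals_single weighted_sum_single W.smult_assoc1[symmetric] mult.commute intro!: formals_single)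
  qed
  have "a \<in> formals V W \<and> ?e a = \<zero>\<^bsub>W\<^esub>"
    using assms(3)
  proof induction
    case 1
    then show ?case by (simp add: weighted_sum_zero formals_zero)
  next
    case (2 a r c)
    have "r \<in> formals V W" using 2 relators_subset_formals[OF assms(1)] by blast
    then show ?case
      using 2 relator by (simp add: weighted_sum_add weighted_sum_scale formals_add formals_scale)
  qed
  then show ?thesis by (simp add: formal_eval_eq_weighted_sum)
qed

end

section \<open>The span of the relators\<close>

lemma relator_span_scale:
  assumes "a \<in> relator_span V W"
  shows "Poly_Mapping.map ((*) c) a \<in> relator_span V W"
  using assms
proof induction
  case 1
  then show ?case by (simp add: relator_span.intros)
next
  case (2 a r e)
  then show ?case
    by (simp add: map_times_add map_times_map_times relator_span.intros)
qed

lemma relator_span_add: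
  assumes "a \<in> relator_span V W" and "b \<in> relator_span V W"
  shows "a + b \<in> relator_span V W"
  using assms(2)
proof induction
  case (2 b r c)
  then have "(a + b) + Poly_Mapping.map ((*) c) r \<in> relator_span V W"
    by (intro relator_span.intros)
  then show ?case by (simp add: add.assoc)
qed (use assms(1) in simp)

lemma relator_span_diff:
  assumes "a \<in> relator_span V W" and "b \<in> relator_span V W"
  shows "a - b \<in> relator_span V W"
  using relator_span_add[OF assms(1) relator_span_scale[OF assms(2), of "- 1"]]
  by (simp add: map_times_minus_one)

lemma relator_span_sum:
  assumes "\<And>i. i \<in> I \<Longrightarrow> f i \<in> relator_span V W"
  shows "sum f I \<in> relator_span V W"
  using assms by (induction I rule: infinite_finite_induct) (auto intro: relator_span_add relator_span.intros)

lemma relator_span_relator: "r \<in> relators V W \<Longrightarrow> Poly_Mapping.map ((*) c) r \<in> relator_span V W"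
  using relator_span.intros(2)[OF relator_span.intros(1), of r V W c] by simp

lemma map_times_single:
  "Poly_Mapping.map ((*) c) (Poly_Mapping.single x e) = Poly_Mapping.single x (c * e :: 'k::field)"
  by (rule poly_mapping_eqI) (simp add: lookup_single when_def)

lemma single_add_functional:
  assumes "set_mset m \<subseteq> carrier (dual V)" "l \<in> carrier (dual V)" "l' \<in> carrier (dual V)" "w \<in> carrier W"
  shows "Poly_Mapping.single (add_mset (l \<oplus>\<^bsub>dual V\<^esub> l') m, w) c
    - (Poly_Mapping.single (add_mset l m, w) c + Poly_Mapping.single (add_mset l' m, w) c) \<in> relator_span V W"
  using relator_span_relator[OF relators.add_functional[OF assms], of c]
  by (simp add: map_times_diff map_times_single diff_diff_eq[symmetric] del: dual_simps)

lemma single_smult_functional: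
  assumes "set_mset m \<subseteq> carrier (dual V)" "l \<in> carrier (dual V)" "w \<in> carrier W"
  shows "Poly_Mapping.single (add_mset (e \<odot>\<^bsub>dual V\<^esub> l) m, w) c
    - Poly_Mapping.single (add_mset l m, w) (c * e) \<in> relator_span V W"
  using relator_span_relator[OF relators.smult_functional[OF assms], of c e]
  by (simp add: map_times_diff map_times_single)

lemma single_add_vector:
  assumes "set_mset m \<subseteq> carrier (dual V)" "w \<in> carrier W" "w' \<in> carrier W"
  shows "Poly_Mapping.single (m, w \<oplus>\<^bsub>W\<^esub> w') c
    - (Poly_Mapping.single (m, w) c + Poly_Mapping.single (m, w') c) \<in> relator_span V W"
  using relator_span_relator[OF relators.add_vector[OF assms], of c]
  by (simp add: map_times_diff map_times_single diff_diff_eq[symmetric] del: dual_simps)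

lemma single_smult_vector:
  assumes "set_mset m \<subseteq> carrier (dual V)" "w \<in> carrier W"
  shows "Poly_Mapping.single (m, e \<odot>\<^bsub>W\<^esub> w) c - Poly_Mapping.single (m, w) (c * e) \<in> relator_span V W"
  using relator_span_relator[OF relators.smult_vector[OF assms], of c e]
  by (simp add: map_times_diff map_times_single)

section \<open>Homogeneous polynomial maps are determined by their values\<close>

lemma single_zero_vector:
  fixes V :: "('k::field, 'v) module" and W :: "('k, 'w) module"
  assumes "kspace W" and "set_mset m \<subseteq> carrier (dual V)"
  shows "Poly_Mapping.single (m, \<zero>\<^bsub>W\<^esub>) c \<in> relator_span V W"
proof -
  interpret W: kspace W by fact
  show ?thesis
    using single_smult_vector[OF assms(2) W.M.zero_closed, of 0 c] by simp
qed

text \<open>Linearity in the vector turns all terms with the same monomial into one term.\<close>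

lemma collect_vectors:
  fixes V :: "('k::field, 'v) module" and W :: "('k, 'w) module"
  assumes "kspace W" and m: "set_mset m \<subseteq> carrier (dual V)"
    and "finite K" and "\<And>x. x \<in> K \<Longrightarrow> fst x = m \<and> snd x \<in> carrier W"
  shows "(\<Sum>x\<in>K. Poly_Mapping.single x (f x)) - Poly_Mapping.single (m, \<Oplus>\<^bsub>W\<^esub>x\<in>K. f x \<odot>\<^bsub>W\<^esub> snd x) 1
    \<in> relator_span V W"
  using assms(3,4)
proof (induction K)
  case empty
  interpret W: kspace W by fact
  show ?case
    using relator_span_scale[OF single_zero_vector[OF assms(1) m, of 1], of "- 1"]
    by (simp add: map_times_minus_one)
next
  case (insert x K)
  interpret W: kspace W by fact
  obtain w where x: "x = (m, w)" "w \<in> carrier W"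
    using insert.prems[of x] by (cases x) auto
  let ?s = "\<Oplus>\<^bsub>W\<^esub>x\<in>K. f x \<odot>\<^bsub>W\<^esub> snd x" and ?f = "f x \<odot>\<^bsub>W\<^esub> w"
  have s: "?s \<in> carrier W"
    using insert.prems by (intro W.M.finsum_closed) auto
  have sum: "(\<Oplus>\<^bsub>W\<^esub>x\<in>insert x K. f x \<odot>\<^bsub>W\<^esub> snd x) = ?f \<oplus>\<^bsub>W\<^esub> ?s"
    using insert x by (subst W.M.finsum_insert) auto
  let ?S = "\<lambda>u. Poly_Mapping.single (m, u) (1 :: 'k)"
  have 1: "?S (?f \<oplus>\<^bsub>W\<^esub> ?s) - (?S ?f + ?S ?s) \<in> relator_span V W"
    using x s by (intro single_add_vector m) auto
  have 2: "?S ?f - Poly_Mapping.single (m, w) (f x) \<in> relator_span V W"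
    using single_smult_vector[OF m x(2), of "f x" 1] by simp
  have 3: "(\<Sum>x\<in>K. Poly_Mapping.single x (f x)) - ?S ?s \<in> relator_span V W"
    using insert by simp
  have eq: "(\<Sum>x\<in>insert x K. Poly_Mapping.single x (f x)) - ?S (?f \<oplus>\<^bsub>W\<^esub> ?s)
      = ((\<Sum>x\<in>K. Poly_Mapping.single x (f x)) - ?S ?s)
        - ((?S (?f \<oplus>\<^bsub>W\<^esub> ?s) - (?S ?f + ?S ?s)) + (?S ?f - Poly_Mapping.single (m, w) (f x)))"
    using insert.hyps x by simp
  from relator_span_diff[OF 3 relator_span_add[OF 1 2]] show ?case
    unfolding sum eq .
qed

text \<open>Grouping the terms by their monomial, each group is congruent to the monomial with its coefficient
vector, which is zero.\<close>

lemma relator_span_if_components_vanish: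
  fixes V :: "('k::field, 'v) module" and W :: "('k, 'w) module"
  assumes W: "kspace W" and a: "a \<in> formals V W"
    and vanish: "\<And>m. weighted_sum W (\<lambda>m'. of_bool (m' = m)) a = \<zero>\<^bsub>W\<^esub>"
  shows "a \<in> relator_span V W"
proof -
  interpret W: kspace W by fact
  let ?l = "Poly_Mapping.lookup a"
  let ?K = "\<lambda>m. {x \<in> Poly_Mapping.keys a. fst x = m}"
  have im: "set_mset (fst x) \<subseteq> carrier (dual V)" "snd x \<in> carrier W" if "x \<in> Poly_Mapping.keys a" for x
    using a that by (cases x, force simp: formals_def)+
  have part: "(\<Sum>x\<in>?K m. Poly_Mapping.single x (?l x)) \<in> relator_span V W"
    if "m \<in> fst ` Poly_Mapping.keys a" for m
  proof -
    have m: "set_mset m \<subseteq> carrier (dual V)"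
      using that im(1) by auto
    have "weighted_sum W (\<lambda>m'. of_bool (m' = m)) a = (\<Oplus>\<^bsub>W\<^esub>x\<in>?K m. ?l x \<odot>\<^bsub>W\<^esub> snd x)"
      unfolding weighted_sum_def
      by (rule W.M.add.finprod_mono_neutral_cong_right) (auto dest: im(2))
    then have "(\<Oplus>\<^bsub>W\<^esub>x\<in>?K m. ?l x \<odot>\<^bsub>W\<^esub> snd x) = \<zero>\<^bsub>W\<^esub>"
      using vanish by simp
    moreover have "(\<Sum>x\<in>?K m. Poly_Mapping.single x (?l x))
        - Poly_Mapping.single (m, \<Oplus>\<^bsub>W\<^esub>x\<in>?K m. ?l x \<odot>\<^bsub>W\<^esub> snd x) 1 \<in> relator_span V W"
      by (rule collect_vectors[OF W m]) (auto dest: im(2))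
    ultimately show ?thesis
      using relator_span_add[OF _ single_zero_vector[OF W m, of 1]] by fastforce
  qed
  have eq: "a = (\<Sum>m\<in>fst ` Poly_Mapping.keys a. \<Sum>x\<in>?K m. Poly_Mapping.single x (?l x))"
    by (subst sum.image_gen[symmetric]) (simp_all add: sum_single_lookup)
  show ?thesis
    by (subst eq) (rule relator_span_sum[OF part])
qed

text \<open>The functionals of a monomial are replaced one after the other by their expansions in the coordinates,
using linearity in each factor; the number of factors does not change.\<close>

lemma homogeneous_normal_form:
  fixes V :: "('k::field, 'v) module" and W :: "('k, 'w) module"
  assumes V: "kspace V" and D: "coordinates V D"
    and a: "a \<in> formals V W" and hom: "\<And>x. x \<in> Poly_Mapping.keys a \<Longrightarrow> size (fst x) = d"
  shows "\<exists>a'\<in>formals V W. (\<forall>x\<in>Poly_Mapping.keys a'. set_mset (fst x) \<subseteq> D \<and> size (fst x) = d) \<and>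
    a - a' \<in> relator_span V W"
proof -
  interpret D: kspace "dual V" by (rule kspace_dual) fact
  have D_dual: "D \<subseteq> carrier (dual V)" and finD: "finite D"
    using D by (auto simp: coordinates_def)
  obtain e where e: "\<And>b. b \<in> D \<Longrightarrow> e b \<in> carrier V"
    "\<And>b b'. b \<in> D \<Longrightarrow> b' \<in> D \<Longrightarrow> b' (e b) = of_bool (b' = b)"
    using coordinates_dual_basis[OF D] by blast
  define N where "N k = {a' \<in> formals V W. \<forall>x\<in>Poly_Mapping.keys a'. set_mset (fst x) \<subseteq> D \<and> size (fst x) = k}" for k
  define R where "R k = {a. \<exists>a'\<in>N k. a - a' \<in> relator_span V W}" for k
  have N_zero: "0 \<in> N k" for k
    by (simp add: N_def formals_zero)
  have N_R: "b \<in> R k" if "b \<in> N k" for b k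
    using that relator_span.intros(1) by (auto simp: R_def intro!: bexI[of _ b])
  have R_add: "b + b' \<in> R k" if bb': "b \<in> R k" "b' \<in> R k" for b b' k
  proof -
    obtain c c' where c: "c \<in> N k" "b - c \<in> relator_span V W" "c' \<in> N k" "b' - c' \<in> relator_span V W"
      using bb' unfolding R_def by blast
    have "c + c' \<in> N k"
      using c keys_add[of c c'] by (auto simp: N_def intro: formals_add)
    moreover have "(b + b') - (c + c') \<in> relator_span V W"
      using relator_span_add[OF c(2,4)] by (simp add: algebra_simps)
    ultimately show ?thesis by (auto simp: R_def)
  qed
  have R_cong: "b \<in> R k" if bb': "b - b' \<in> relator_span V W" "b' \<in> R k" for b b' k
  proof -
    obtain c where "c \<in> N k" "b' - c \<in> relator_span V W"
      using bb' unfolding R_def by blast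
    then show ?thesis
      using relator_span_add[OF bb'(1)] by (fastforce simp: R_def)
  qed
  \<comment> \<open>The factors in \<open>n\<close> are already coordinates; the induction moves the factors of \<open>m\<close> to \<open>n\<close>.\<close>
  have monomial: "Poly_Mapping.single (m + n, w) c \<in> R (size m + size n)"
    if "set_mset m \<subseteq> carrier (dual V)" "set_mset n \<subseteq> D" "w \<in> carrier W" for m n w c
    using that
  proof (induction m arbitrary: n c)
    case empty
    then have "Poly_Mapping.single (n, w) c \<in> N (size n)"
      using D_dual by (auto simp: N_def intro!: formals_single split: if_splits)
    then show ?case by (simp add: N_R)
  next
    case (add l m)
    let ?k = "size (add_mset l m) + size n"
    have mn: "set_mset (m + n) \<subseteq> carrier (dual V)" and l: "l \<in> carrier (dual V)"
      using add.prems D_dual by auto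
    \<comment> \<open>Partial sums of the coordinate expansion of \<open>l\<close>, to use additivity one summand at a time.\<close>
    define part where "part C = (\<lambda>v\<in>carrier V. \<Sum>b\<in>C. l (e b) * b v)" for C
    have "part C \<in> carrier (dual V) \<and> Poly_Mapping.single (add_mset (part C) (m + n), w) c \<in> R ?k"
      if "finite C" "C \<subseteq> D" for C
      using that
    proof (induction C)
      case empty
      have part: "part {} = 0 \<odot>\<^bsub>dual V\<^esub> l"
        by (simp add: part_def)
      have "Poly_Mapping.single (add_mset (part {}) (m + n), w) c - 0 \<in> relator_span V W"
        unfolding part using single_smult_functional[OF mn l add.prems(3), of 0 c] by (simp del: dual_simps)
      then have "Poly_Mapping.single (add_mset (part {}) (m + n), w) c \<in> R ?k"
        by (rule R_cong) (rule N_R[OF N_zero])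
      moreover have "part {} \<in> carrier (dual V)"
        unfolding part using l by (rule D.smult_closed[OF UNIV_I])
      ultimately show ?case by blast
    next
      case (insert b C)
      have b: "b \<in> carrier (dual V)" "b \<in> D"
        using insert.prems D_dual by auto
      let ?lb = "l (e b) \<odot>\<^bsub>dual V\<^esub> b"
      have lb: "?lb \<in> carrier (dual V)"
        using b(1) by (rule D.smult_closed[OF UNIV_I])
      have IH: "part C \<in> carrier (dual V)" "Poly_Mapping.single (add_mset (part C) (m + n), w) c \<in> R ?k"
        using insert by auto
      have part: "part (insert b C) = ?lb \<oplus>\<^bsub>dual V\<^esub> part C"
        using insert.hyps by (auto simp: part_def fun_eq_iff)
      have "Poly_Mapping.single (m + add_mset b n, w) (c * l (e b)) \<in> R (size m + size (add_mset b n))"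
        by (rule add.IH) (use add.prems b in auto)
      then have "Poly_Mapping.single (add_mset b (m + n), w) (c * l (e b)) \<in> R ?k"
        by simp
      then have "Poly_Mapping.single (add_mset ?lb (m + n), w) c \<in> R ?k"
        by (rule R_cong[OF single_smult_functional[OF mn b(1) add.prems(3)]])
      then have "Poly_Mapping.single (add_mset (part (insert b C)) (m + n), w) c \<in> R ?k"
        unfolding part using R_cong[OF single_add_functional[OF mn lb IH(1) add.prems(3)] R_add[OF _ IH(2)]] by blast
      moreover have "part (insert b C) \<in> carrier (dual V)"
        unfolding part using lb IH(1) by (rule D.M.a_closed)
      ultimately show ?case by blast
    qed
    from this[OF finD order_refl] have "Poly_Mapping.single (add_mset (part D) (m + n), w) c \<in> R ?k"
      by blast
    moreover have "part D = l"
      unfolding part_def by (rule dual_eq_coordinate_sum[OF V D e l, symmetric])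
    ultimately show ?case by simp
  qed
  have "(\<Sum>x\<in>K. Poly_Mapping.single x (Poly_Mapping.lookup a x)) \<in> R d"
    if "finite K" "K \<subseteq> Poly_Mapping.keys a" for K
    using that
  proof (induction K)
    case empty
    show ?case using N_R[OF N_zero] by simp
  next
    case (insert x K)
    obtain m w where x: "x = (m, w)" by (cases x)
    then have "set_mset m \<subseteq> carrier (dual V)" "w \<in> carrier W" "size m = d"
      using a hom insert.prems by (force simp: formals_def)+
    then have "Poly_Mapping.single x (Poly_Mapping.lookup a x) \<in> R d"
      using monomial[of m "{#}" w] x by auto
    then show ?case using insert by (auto intro: R_add)
  qed
  from this[of "Poly_Mapping.keys a"] have "a \<in> R d"
    by (simp add: sum_single_lookup)
  then show ?thesis by (auto simp: R_def N_def)
qed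

lemma weighted_sum_cong:
  assumes "kspace W" and "a \<in> formals V W" and "\<And>x. x \<in> Poly_Mapping.keys a \<Longrightarrow> \<chi> (fst x) = \<xi> (fst x)"
  shows "weighted_sum W \<chi> a = weighted_sum W \<xi> a"
proof -
  interpret W: kspace W by fact
  show ?thesis
    unfolding weighted_sum_def
    by (rule W.M.finsum_cong') (use assms in \<open>auto simp: formals_def\<close>)
qed

text \<open>In normal form, the coefficient of a monomial is a linear combination of values at the points whose
coordinates lie on the interpolation grid, so it vanishes.\<close>

theorem homogeneous_eval_zero_imp_relator_span:
  fixes V :: "('k::field, 'v) module" and W :: "('k, 'w) module"
  assumes k: "infinite (UNIV :: 'k set) \<or> d \<le> card (UNIV :: 'k set)"
    and V: "kspace V" and D: "coordinates V D" and W: "kspace W"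
    and a: "a \<in> formals V W" and hom: "\<And>x. x \<in> Poly_Mapping.keys a \<Longrightarrow> size (fst x) = d"
    and zero: "\<And>v. v \<in> carrier V \<Longrightarrow> formal_eval W v a = \<zero>\<^bsub>W\<^esub>"
  shows "a \<in> relator_span V W"
proof -
  obtain a' where a': "a' \<in> formals V W" "a - a' \<in> relator_span V W"
    and normal: "\<And>x. x \<in> Poly_Mapping.keys a' \<Longrightarrow> set_mset (fst x) \<subseteq> D \<and> size (fst x) = d"
    using homogeneous_normal_form[OF V D a hom] by blast
  have zero': "weighted_sum W (\<lambda>m. \<Prod>l\<in>#m. l v) a' = \<zero>\<^bsub>W\<^esub>" if "v \<in> carrier V" for v
    using formal_eval_relator_span[OF W V that a'(2)] weighted_sum_diff_eq_zero_iff[OF W a a'(1)] zero[OF that]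
    by (simp add: formal_eval_eq_weighted_sum)
  have "weighted_sum W (\<lambda>m'. of_bool (m' = m)) a' = \<zero>\<^bsub>W\<^esub>" for m
  proof (cases "set_mset m \<subseteq> D \<and> size m = d")
    case True
    have finD: "finite D" using D by (simp add: coordinates_def)
    obtain T :: "(('v \<Rightarrow> 'k) \<Rightarrow> 'k) set" and c where T: "finite T"
      and c: "\<And>m'. size m' = d \<Longrightarrow> set_mset m' \<subseteq> D \<Longrightarrow> (\<Sum>t\<in>T. c t * (\<Prod>l\<in>#m'. t l)) = of_bool (m' = m)"
      using homogeneous_monomials_dual_basis[OF k finD, of m] True by auto
    have "\<forall>t. \<exists>v. v \<in> carrier V \<and> (\<forall>l\<in>D. l v = t l)"
      using D unfolding coordinates_def Bex_def by (elim conjE)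
    from choice[OF this] obtain v where "\<forall>t. v t \<in> carrier V \<and> (\<forall>l\<in>D. l (v t) = t l)" ..
    then have v: "v t \<in> carrier V" "\<forall>l\<in>D. l (v t) = t l" for t
      by simp_all
    have "weighted_sum W (\<lambda>m'. \<Sum>t\<in>T. c t * (\<Prod>l\<in>#m'. l (v t))) a' = \<zero>\<^bsub>W\<^esub>"
      by (rule weighted_sum_weights_vanish[OF W a'(1) T]) (rule zero'[OF v(1)])
    also have "weighted_sum W (\<lambda>m'. \<Sum>t\<in>T. c t * (\<Prod>l\<in>#m'. l (v t))) a'
        = weighted_sum W (\<lambda>m'. of_bool (m' = m)) a'"
    proof (rule weighted_sum_cong[OF W a'(1)])
      fix x assume x: "x \<in> Poly_Mapping.keys a'"
      have "image_mset (\<lambda>l. l (v t)) (fst x) = image_mset t (fst x)" for t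
        by (rule image_mset_cong) (use normal[OF x] v(2)[of t] in blast)
      then show "(\<Sum>t\<in>T. c t * (\<Prod>l\<in>#fst x. l (v t))) = of_bool (fst x = m)"
        using c[of "fst x"] normal[OF x] by simp
    qed
    finally show ?thesis .
  next
    case False
    then have "weighted_sum W (\<lambda>m'. of_bool (m' = m)) a' = weighted_sum W (\<lambda>m'. 0) a'"
      by (intro weighted_sum_cong[OF W a'(1)]) (auto dest!: normal)
    also have "\<dots> = \<zero>\<^bsub>W\<^esub>"
      using weighted_sum_weights_vanish[OF W a'(1), of "{} :: nat set"] by simp
    finally show ?thesis .
  qed
  then have "a' \<in> relator_span V W"
    by (rule relator_span_if_components_vanish[OF W a'(1)])
  from relator_span_add[OF a'(2) this] show ?thesis by simp
qed

section \<open>Polynomial maps as classes, and composition with a linear map\<close>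

lemma equiv_formal_rel:
  fixes V :: "('k::field, 'v) module" and W :: "('k, 'w) module"
  shows "equiv (formals V W) (formal_rel V W)"
proof (rule equivI)
  show "sym (formal_rel V W)"
    using relator_span_scale[where c = "- 1"]
    by (fastforce simp: sym_def formal_rel_def map_times_minus_one)
  show "trans (formal_rel V W)"
    using relator_span_add by (fastforce simp: trans_def formal_rel_def)
qed (auto simp: refl_on_def formal_rel_def relator_span.intros)

lemma poly_maps_eq_class:
  fixes V :: "('k::field, 'v) module" and W :: "('k, 'w) module"
  assumes "F \<in> poly_maps V W" and "a \<in> F"
  shows "a \<in> formals V W" and "F = formal_rel V W `` {a}"
proof -
  obtain b where b: "b \<in> formals V W" "F = formal_rel V W `` {b}"
    using assms(1) by (auto simp: poly_maps_def elim: quotientE)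
  then show "a \<in> formals V W"
    using assms(2) by (auto simp: formal_rel_def)
  show "F = formal_rel V W `` {a}"
    using b assms(2) equiv_class_eq[OF equiv_formal_rel] by blast
qed

text \<open>Since evaluation kills the relators, any representative computes the value.\<close>

lemma pm_eval_eq_formal_eval:
  fixes V :: "('k::field, 'v) module" and W :: "('k, 'w) module"
  assumes V: "kspace V" and W: "kspace W" and F: "F \<in> poly_maps V W" "a \<in> F" and v: "v \<in> carrier V"
  shows "pm_eval W F v = formal_eval W v a"
proof -
  have "formal_eval W v b = formal_eval W v a" if "b \<in> F" for b
  proof -
    have "(a, b) \<in> formal_rel V W"
      using poly_maps_eq_class(2)[OF F] that by blast
    then show ?thesis
      using formal_eval_relator_span[OF W V v, of "a - b"]
        weighted_sum_diff_eq_zero_iff[OF W, of a V b]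
      by (auto simp: formal_rel_def formal_eval_eq_weighted_sum)
  qed
  then have "formal_eval W v ` F = {formal_eval W v a}"
    using F(2) by blast
  then show ?thesis by (simp add: pm_eval_def)
qed

text \<open>The map on representatives that underlies \<open>pm_post\<close>.\<close>

definition formal_post :: "('u \<Rightarrow> 'w) \<Rightarrow> ('k::field, 'v, 'u) formal \<Rightarrow> ('k, 'v, 'w) formal" where
  "formal_post f a = (\<Sum>x\<in>Poly_Mapping.keys a. Poly_Mapping.single (fst x, f (snd x)) (Poly_Mapping.lookup a x))"

lemma pm_post_eq_image: "pm_post V W f F = formal_rel V W `` (formal_post f ` F)"
  by (simp add: pm_post_def formal_post_def[abs_def])

lemma formal_post_superset:
  assumes "finite A" and "Poly_Mapping.keys a \<subseteq> A"
  shows "formal_post f a = (\<Sum>x\<in>A. Poly_Mapping.single (fst x, f (snd x)) (Poly_Mapping.lookup a x))"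
  unfolding formal_post_def
  by (rule sum.mono_neutral_left) (use assms in \<open>auto simp: in_keys_iff\<close>)

lemma formal_post_add: "formal_post f (a + b) = formal_post f a + formal_post f b"
proof -
  let ?A = "Poly_Mapping.keys a \<union> Poly_Mapping.keys b"
  have "formal_post f (a + b) = (\<Sum>x\<in>?A. Poly_Mapping.single (fst x, f (snd x)) (Poly_Mapping.lookup (a + b) x))"
    by (rule formal_post_superset) (use keys_add[of a b] in auto)
  also have "\<dots> = formal_post f a + formal_post f b"
    by (simp add: formal_post_superset[of ?A] lookup_add single_add sum.distrib)
  finally show ?thesis .
qed

lemma formal_post_diff: "formal_post f (a - b) = formal_post f a - formal_post f b"
  using formal_post_add[of f "a - b" b] by (simp add: eq_diff_eq)

lemma formal_post_zero [simp]: "formal_post f 0 = 0"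
  by (simp add: formal_post_def)

lemma formal_post_single [simp]:
  "formal_post f (Poly_Mapping.single (m, u) c) = Poly_Mapping.single (m, f u) c"
  by (cases "c = 0") (simp_all add: formal_post_def)

lemma formal_post_scale:
  "formal_post f (Poly_Mapping.map ((*) c) a) = Poly_Mapping.map ((*) c) (formal_post f a)"
proof -
  have "formal_post f (Poly_Mapping.map ((*) c) a)
      = (\<Sum>x\<in>Poly_Mapping.keys a. Poly_Mapping.single (fst x, f (snd x)) (c * Poly_Mapping.lookup a x))"
    by (subst formal_post_superset[of "Poly_Mapping.keys a"]) (auto simp: in_keys_iff)
  also have "\<dots> = Poly_Mapping.map ((*) c) (formal_post f a)"
    by (rule poly_mapping_eqI)
      (auto simp: formal_post_def lookup_sum lookup_single when_def sum_distrib_left intro!: sum.cong)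
  finally show ?thesis .
qed

lemma keys_formal_post:
  "Poly_Mapping.keys (formal_post f a) \<subseteq> (\<lambda>x. (fst x, f (snd x))) ` Poly_Mapping.keys a"
proof -
  have "Poly_Mapping.keys (formal_post f a) \<subseteq>
      (\<Union>x\<in>Poly_Mapping.keys a. Poly_Mapping.keys (Poly_Mapping.single (fst x, f (snd x)) (Poly_Mapping.lookup a x)))"
    unfolding formal_post_def by (rule keys_sum)
  then show ?thesis by (auto split: if_splits)
qed

lemma formal_post_closed:
  fixes a :: "('k::field, 'v, 'u) formal"
  assumes "f \<in> carrier U \<rightarrow> carrier W" and "a \<in> formals V U"
  shows "formal_post f a \<in> formals V W"
  using assms keys_formal_post[of f a] by (fastforce simp: formals_def)

lemma weighted_sum_formal_post:
  fixes V :: "('k::field, 'v) module" and U :: "('k, 'u) module" and W :: "('k, 'w) module"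
  assumes U: "kspace U" and W: "kspace W" and f: "f \<in> LinearCombinations.module_hom class_ring U W"
    and a: "a \<in> formals V U"
  shows "weighted_sum W \<chi> (formal_post f a) = f (weighted_sum U \<chi> a)"
  using a
proof (induction rule: formals_induct)
  case zero
  show ?case
    by (simp add: weighted_sum_zero[OF U] weighted_sum_zero[OF W] module_hom_zero[OF U W f])
next
  case (add m u c b)
  have fU: "f \<in> carrier U \<rightarrow> carrier W" using f by (simp add: mem_module_hom_iff)
  have s: "Poly_Mapping.single (m, u) c \<in> formals V U" "Poly_Mapping.single (m, f u) c \<in> formals V W"
    using add fU by (auto intro: formals_single)
  have post: "formal_post f b \<in> formals V W"
    by (rule formal_post_closed[OF fU]) fact
  interpret U: kspace U by fact
  show ?case
    using add f s post
    by (simp add: formal_post_add weighted_sum_add[OF U, of _ V] weighted_sum_add[OF W, of _ V]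
        weighted_sum_single U W weighted_sum_closed[OF U, of _ V] mem_module_hom_iff Pi_iff)
qed

lemma formal_post_relator_span:
  fixes V :: "('k::field, 'v) module" and U :: "('k, 'u) module" and W :: "('k, 'w) module"
  assumes f: "f \<in> LinearCombinations.module_hom class_ring U W" and "a \<in> relator_span V U"
  shows "formal_post f a \<in> relator_span V W"
  using assms(2)
proof induction
  case 1
  then show ?case by (simp add: relator_span.intros)
next
  case (2 a r c)
  have "formal_post f r \<in> relators V W"
    using 2(2)
  proof cases
    case (add_functional m l l' w)
    then show ?thesis
      using f relators.add_functional[of m V l l' "f w" W]
      by (auto simp: formal_post_diff mem_module_hom_iff Pi_iff)
  next
    case (smult_functional m l w c)
    then show ?thesis
      using f relators.smult_functional[of m V l "f w" W c]
      by (auto simp: formal_post_diff mem_module_hom_iff Pi_iff)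
  next
    case (add_vector m w w')
    then show ?thesis
      using f relators.add_vector[of m V "f w" W "f w'"]
      by (auto simp: formal_post_diff mem_module_hom_iff Pi_iff)
  next
    case (smult_vector m w c)
    then show ?thesis
      using f relators.smult_vector[of m V "f w" W c]
      by (auto simp: formal_post_diff mem_module_hom_iff Pi_iff)
  qed
  then show ?case
    using 2 by (simp add: formal_post_add formal_post_scale relator_span.intros)
qed

text \<open>Composition with a linear map sends relators to relators, so one representative suffices.\<close>

lemma pm_post_eq_class:
  fixes V :: "('k::field, 'v) module" and U :: "('k, 'u) module" and W :: "('k, 'w) module"
  assumes f: "f \<in> LinearCombinations.module_hom class_ring U W"
    and F: "F \<in> poly_maps V U" "a \<in> F"
  shows "pm_post V W f F = formal_rel V W `` {formal_post f a}"
proof -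
  have fU: "f \<in> carrier U \<rightarrow> carrier W" using f by (simp add: mem_module_hom_iff)
  have "(formal_post f a, formal_post f b) \<in> formal_rel V W" if "b \<in> F" for b
  proof -
    have "(a, b) \<in> formal_rel V U"
      using poly_maps_eq_class(2)[OF F] that by blast
    then show ?thesis
      using formal_post_relator_span[OF f, of "a - b" V] formal_post_closed[OF fU]
      by (auto simp: formal_rel_def formal_post_diff)
  qed
  then have "formal_rel V W `` {formal_post f b} = formal_rel V W `` {formal_post f a}" if "b \<in> F" for b
    using that by (intro sym[OF equiv_class_eq[OF equiv_formal_rel]])
  then show ?thesis
    unfolding pm_post_eq_image using F(2) by blast
qed

text \<open>For homogeneous maps of the same degree, the equation \<open>f \<circ> F = g \<circ> G\<close> of polynomial maps holds iff it
holds at every \<open>k\<close>-point: the difference of the two representatives is again homogeneous of that degree, so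
it is a combination of relators as soon as it vanishes everywhere.\<close>

theorem pm_post_eq_iff_pointwise:
  fixes V :: "('k::field, 'v) module" and U :: "('k, 'u) module" and U' :: "('k, 'x) module"
    and W :: "('k, 'w) module"
  assumes k: "infinite (UNIV :: 'k set) \<or> d \<le> card (UNIV :: 'k set)"
    and V: "kspace V" and D: "coordinates V D" and U: "kspace U" and U': "kspace U'" and W: "kspace W"
    and f: "f \<in> LinearCombinations.module_hom class_ring U W"
    and g: "g \<in> LinearCombinations.module_hom class_ring U' W"
    and F: "F \<in> poly_maps V U" "homogeneous d F"
    and G: "G \<in> poly_maps V U'" "homogeneous d G"
  shows "pm_post V W f F = pm_post V W g G \<longleftrightarrow>
    (\<forall>v\<in>carrier V. f (pm_eval U F v) = g (pm_eval U' G v))"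
proof -
  obtain a where a: "a \<in> F" "\<And>x. x \<in> Poly_Mapping.keys a \<Longrightarrow> size (fst x) = d"
    using F(2) by (fastforce simp: homogeneous_def)
  obtain b where b: "b \<in> G" "\<And>x. x \<in> Poly_Mapping.keys b \<Longrightarrow> size (fst x) = d"
    using G(2) by (fastforce simp: homogeneous_def)
  have ab: "a \<in> formals V U" "b \<in> formals V U'"
    using poly_maps_eq_class(1) F(1) G(1) a(1) b(1) by blast+
  let ?a = "formal_post f a" and ?b = "formal_post g b"
  have post: "?a \<in> formals V W" "?b \<in> formals V W"
    using f g ab by (auto simp: mem_module_hom_iff intro: formal_post_closed)
  have eval_diff: "formal_eval W v (?a - ?b) = \<zero>\<^bsub>W\<^esub> \<longleftrightarrow> f (pm_eval U F v) = g (pm_eval U' G v)"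
    if "v \<in> carrier V" for v
    using that weighted_sum_diff_eq_zero_iff[OF W post] pm_eval_eq_formal_eval[OF V U F(1) a(1) that]
      pm_eval_eq_formal_eval[OF V U' G(1) b(1) that]
      weighted_sum_formal_post[OF U W f ab(1)] weighted_sum_formal_post[OF U' W g ab(2)]
    by (simp add: formal_eval_eq_weighted_sum)
  have "pm_post V W f F = pm_post V W g G \<longleftrightarrow> (?a, ?b) \<in> formal_rel V W"
    unfolding pm_post_eq_class[OF f F(1) a(1)] pm_post_eq_class[OF g G(1) b(1)]
    by (rule eq_equiv_class_iff[OF equiv_formal_rel post])
  also have "\<dots> \<longleftrightarrow> ?a - ?b \<in> relator_span V W"
    using post by (simp add: formal_rel_def)
  also have "\<dots> \<longleftrightarrow> (\<forall>v\<in>carrier V. formal_eval W v (?a - ?b) = \<zero>\<^bsub>W\<^esub>)"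
  proof
    assume "\<forall>v\<in>carrier V. formal_eval W v (?a - ?b) = \<zero>\<^bsub>W\<^esub>"
    moreover have "size (fst x) = d" if "x \<in> Poly_Mapping.keys (?a - ?b)" for x
    proof -
      have "x \<in> Poly_Mapping.keys ?a \<union> Poly_Mapping.keys ?b"
        using that keys_diff[of ?a ?b] by blast
      then have "fst x \<in> fst ` Poly_Mapping.keys a \<union> fst ` Poly_Mapping.keys b"
        using image_mono[OF keys_formal_post[of f a], of fst] image_mono[OF keys_formal_post[of g b], of fst]
        unfolding image_image fst_conv by blast
      then show ?thesis
        using a(2) b(2) by auto
    qed
    ultimately show "?a - ?b \<in> relator_span V W"
      by (intro homogeneous_eval_zero_imp_relator_span[OF k V D W] formals_diff post) auto
  qed (use formal_eval_relator_span[OF W V] in blast)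
  also have "\<dots> \<longleftrightarrow> (\<forall>v\<in>carrier V. f (pm_eval U F v) = g (pm_eval U' G v))"
    using eval_diff by blast
  finally show ?thesis .
qed

section \<open>Natural transformations form a vector space\<close>

lemma kspace_family_space:
  fixes P :: "('k::field, 'v) module \<Rightarrow> ('k, 'w) module" and Q :: "('k, 'v) module \<Rightarrow> ('k, 'u) module"
  assumes "\<And>V. V \<in> fin_vec \<Longrightarrow> kspace (hom_space (P V) (Q V))"
  shows "kspace (family_space P Q)"
proof -
  note H = kspace.laws[OF assms]
  have zero: "\<zero>\<^bsub>hom_space (P V) (Q V)\<^esub> \<in> carrier (hom_space (P V) (Q V))" if "V \<in> fin_vec" for V
  proof -
    interpret kspace "hom_space (P V) (Q V)" using assms that by blast
    show ?thesis by (rule M.zero_closed)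
  qed
  show ?thesis
  proof (rule kspaceI, goal_cases)
    case (4 \<eta> \<theta>)
    then have "\<eta> V \<oplus>\<^bsub>hom_space (P V) (Q V)\<^esub> \<theta> V = \<theta> V \<oplus>\<^bsub>hom_space (P V) (Q V)\<^esub> \<eta> V" if "V \<in> fin_vec" for V
      using that by (intro H(3)) (auto simp: family_space_def simp del: hom_space_simps)
    then show ?case
      by (simp add: family_space_def restrict_def fun_eq_iff del: hom_space_simps)
  qed (auto simp: family_space_def PiE_iff extensional_def restrict_def zero H(1,2,4-) simp del: hom_space_simps
      intro!: ext)
qed

lemma family_space_zero: "V \<in> fin_vec \<Longrightarrow> \<zero>\<^bsub>family_space P Q\<^esub> V = (\<lambda>x\<in>carrier (P V). \<zero>\<^bsub>Q V\<^esub>)"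
  by (simp add: family_space_def)

lemma family_space_add: "V \<in> fin_vec \<Longrightarrow>
    (\<eta> \<oplus>\<^bsub>family_space P Q\<^esub> \<theta>) V = (\<lambda>x\<in>carrier (P V). \<eta> V x \<oplus>\<^bsub>Q V\<^esub> \<theta> V x)"
  by (simp add: family_space_def)

lemma family_space_smult: "V \<in> fin_vec \<Longrightarrow>
    (c \<odot>\<^bsub>family_space P Q\<^esub> \<eta>) V = (\<lambda>x\<in>carrier (P V). c \<odot>\<^bsub>Q V\<^esub> \<eta> V x)"
  by (simp add: family_space_def)

text \<open>Naturality is a linear condition on the family, because the values of \<open>G\<close> on maps are
linear; so the natural transformations form a subspace of the space of all families.\<close>

lemma kspace_vect_Hom:
  fixes F :: "('k::field, 'v, 'w) vect_functor" and G :: "('k, 'v, 'u) vect_functor"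
  assumes F: "\<And>V. V \<in> fin_vec \<Longrightarrow> kspace (fobj F V)" and G: "\<And>V. V \<in> fin_vec \<Longrightarrow> kspace (fobj G V)"
    and Fmap: "\<And>V W f. V \<in> fin_vec \<Longrightarrow> W \<in> fin_vec \<Longrightarrow> f \<in> carrier (hom_space V W) \<Longrightarrow>
      fmap F V W f \<in> carrier (hom_space (fobj F V) (fobj F W))"
    and Gmap: "\<And>V W f. V \<in> fin_vec \<Longrightarrow> W \<in> fin_vec \<Longrightarrow> f \<in> carrier (hom_space V W) \<Longrightarrow>
      fmap G V W f \<in> carrier (hom_space (fobj G V) (fobj G W))"
  shows "kspace (vect_Hom F G)"
proof -
  let ?S = "family_space (fobj F) (fobj G)"
  interpret S: kspace ?S
    by (intro kspace_family_space kspace_hom_space F G)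
  define natural where "natural \<eta> \<longleftrightarrow> (\<forall>V\<in>fin_vec. \<forall>W\<in>fin_vec. \<forall>f\<in>carrier (hom_space V W).
    \<forall>x\<in>carrier (fobj F V). \<eta> W (fmap F V W f x) = fmap G V W f (\<eta> V x))"
    for \<eta> :: "('k, 'v) module \<Rightarrow> 'w \<Rightarrow> 'u"
  let ?N = "{\<eta> \<in> carrier ?S. natural \<eta>}"
  have vect_Hom: "vect_Hom F G = ?S\<lparr>carrier := ?N\<rparr>"
    unfolding vect_Hom_def natural_def compose_def restrict_def by (simp add: fun_eq_iff Ball_def)
  have hom: "\<eta> V x \<in> carrier (fobj G V)" if "\<eta> \<in> carrier ?S" "V \<in> fin_vec" "x \<in> carrier (fobj F V)" for \<eta> V x
    using that by (auto simp: family_space_def PiE_iff mem_module_hom_iff Pi_iff)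
  have Fx: "fmap F V W f x \<in> carrier (fobj F W)"
    if "V \<in> fin_vec" "W \<in> fin_vec" "f \<in> carrier (hom_space V W)" "x \<in> carrier (fobj F V)" for V W f x
    using Fmap[OF that(1-3)] that(4) by (auto simp: mem_module_hom_iff)
  have Gf: "fmap G V W f \<in> LinearCombinations.module_hom class_ring (fobj G V) (fobj G W)"
    if "V \<in> fin_vec" "W \<in> fin_vec" "f \<in> carrier (hom_space V W)" for V W f
    using Gmap[OF that] by simp
  have "submodule class_ring ?N ?S"
  proof (rule LinearCombinations.submodule.intro)
    show "module class_ring ?S" using S.vectorspace by (rule vectorspace.axioms)
    show "?N \<subseteq> carrier ?S" by blast
  next
    fix \<eta> \<theta> assume *: "\<eta> \<in> ?N" "\<theta> \<in> ?N"
    then have "\<eta> \<oplus>\<^bsub>?S\<^esub> \<theta> \<in> carrier ?S" by simp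
    moreover have "natural (\<eta> \<oplus>\<^bsub>?S\<^esub> \<theta>)"
      unfolding natural_def
    proof (intro ballI)
      fix V W :: "('k, 'v) module" and f x
      assume V: "V \<in> fin_vec" and W: "W \<in> fin_vec" and f: "f \<in> carrier (hom_space V W)"
        and x: "x \<in> carrier (fobj F V)"
      have "\<eta> W (fmap F V W f x) = fmap G V W f (\<eta> V x)" "\<theta> W (fmap F V W f x) = fmap G V W f (\<theta> V x)"
        using * V W f x by (auto simp: natural_def)
      then show "(\<eta> \<oplus>\<^bsub>?S\<^esub> \<theta>) W (fmap F V W f x) = fmap G V W f ((\<eta> \<oplus>\<^bsub>?S\<^esub> \<theta>) V x)"
        using V W x Fx[OF V W f x] LinearCombinations.module_hom_add[OF Gf[OF V W f]] hom * by (simp add: family_space_add)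
    qed
    ultimately show "\<eta> \<oplus>\<^bsub>?S\<^esub> \<theta> \<in> ?N" by blast
  next
    have "natural \<zero>\<^bsub>?S\<^esub>"
      unfolding natural_def
    proof (intro ballI)
      fix V W :: "('k, 'v) module" and f x
      assume V: "V \<in> fin_vec" and W: "W \<in> fin_vec" and f: "f \<in> carrier (hom_space V W)"
        and x: "x \<in> carrier (fobj F V)"
      have "fmap G V W f \<zero>\<^bsub>fobj G V\<^esub> = \<zero>\<^bsub>fobj G W\<^esub>"
        using module_hom_zero[OF G[OF V] G[OF W] Gf[OF V W f]] .
      then show "\<zero>\<^bsub>?S\<^esub> W (fmap F V W f x) = fmap G V W f (\<zero>\<^bsub>?S\<^esub> V x)"
        using V W x Fx[OF V W f x] by (simp add: family_space_zero)
    qed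
    then show "\<zero>\<^bsub>?S\<^esub> \<in> ?N" using S.M.zero_closed by blast
  next
    fix c \<eta> assume *: "\<eta> \<in> ?N"
    then have "c \<odot>\<^bsub>?S\<^esub> \<eta> \<in> carrier ?S" using S.smult_closed by blast
    moreover have "natural (c \<odot>\<^bsub>?S\<^esub> \<eta>)"
      unfolding natural_def
    proof (intro ballI)
      fix V W :: "('k, 'v) module" and f x
      assume V: "V \<in> fin_vec" and W: "W \<in> fin_vec" and f: "f \<in> carrier (hom_space V W)"
        and x: "x \<in> carrier (fobj F V)"
      have "\<eta> W (fmap F V W f x) = fmap G V W f (\<eta> V x)"
        using * V W f x by (auto simp: natural_def)
      then show "(c \<odot>\<^bsub>?S\<^esub> \<eta>) W (fmap F V W f x) = fmap G V W f ((c \<odot>\<^bsub>?S\<^esub> \<eta>) V x)"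
        using V W x Fx[OF V W f x] LinearCombinations.module_hom_smult[OF Gf[OF V W f]] hom * by (simp add: family_space_smult)
    qed
    ultimately show "c \<odot>\<^bsub>?S\<^esub> \<eta> \<in> ?N" by blast
  qed
  then have "subspace class_ring ?N ?S"
    by (intro VectorSpace.subspace.intro S.vectorspace)
  then have "vectorspace class_ring (?S\<lparr>carrier := ?N\<rparr>)"
    by (rule S.subspace_is_vs)
  then show ?thesis
    unfolding vect_Hom by (rule kspace.intro)
qed

lemma linear_map_id:
  fixes V :: "('k::field, 'v) module"
  assumes "kspace V"
  shows "linear_map class_ring V V (\<lambda>v. v)"
proof -
  interpret kspace V by fact
  show ?thesis
    by (intro linear_map.intro mod_hom.intro mod_hom_axioms.intro vectorspace) (auto simp: mem_module_hom_iff, unfold_locales)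
qed

section \<open>Strict and ordinary natural transformations\<close>

lemma strict_poly_functorD:
  assumes "strict_poly_functor P" and "V \<in> fin_vec" and "W \<in> fin_vec"
  shows "kspace (sobj P V)"
    and "smap P V W \<in> poly_maps (hom_space V W) (hom_space (sobj P V) (sobj P W))"
  using assms by (auto simp: strict_poly_functor_def intro: fin_vec_kspace)

lemma fobj_forget [simp]: "fobj (forget P) = sobj P"
  by (simp add: forget_def)

lemma fmap_forget_closed:
  fixes P :: "('k::field, 'v, 'w) strict_functor"
  assumes P: "strict_poly_functor P" and V: "V \<in> fin_vec" and W: "W \<in> fin_vec" and f: "f \<in> carrier (hom_space V W)"
  shows "fmap (forget P) V W f \<in> carrier (hom_space (sobj P V) (sobj P W))"
proof -
  let ?H = "hom_space V W" and ?K = "hom_space (sobj P V) (sobj P W)"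
  have H: "kspace ?H" and K: "kspace ?K"
    using strict_poly_functorD(1)[OF P] V W by (auto intro: kspace_hom_space fin_vec_kspace)
  have F: "smap P V W \<in> poly_maps ?H ?K"
    using strict_poly_functorD(2)[OF P V W] .
  then obtain a where a: "a \<in> smap P V W"
    using in_quotient_imp_non_empty[OF equiv_formal_rel] by (fastforce simp: poly_maps_def)
  have "pm_eval ?K (smap P V W) f \<in> carrier ?K"
    unfolding pm_eval_eq_formal_eval[OF H K F a f] formal_eval_eq_weighted_sum
    by (rule weighted_sum_closed[OF K poly_maps_eq_class(1)[OF F a]])
  then show ?thesis
    using f by (simp add: forget_def)
qed

text \<open>For fixed \<open>V\<close> and \<open>W\<close> both sides of the naturality square arise from \<open>P\<^sub>V\<^sub>W\<close> and \<open>Q\<^sub>V\<^sub>W\<close> by composition with a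
linear map, \<open>\<phi> \<mapsto> \<eta>\<^sub>W \<circ> \<phi>\<close> and \<open>\<psi> \<mapsto> \<psi> \<circ> \<eta>\<^sub>V\<close>, so the pointwise criterion applies.\<close>

lemma strict_Hom_eq_vect_Hom:
  fixes P :: "('k::field, 'v, 'w) strict_functor" and Q :: "('k, 'v, 'u) strict_functor"
  assumes k: "infinite (UNIV :: 'k set) \<or> d \<le> card (UNIV :: 'k set)"
    and P: "strict_poly_functor P" "homogeneous_functor d P"
    and Q: "strict_poly_functor Q" "homogeneous_functor d Q"
  shows "strict_Hom P Q = vect_Hom (forget P) (forget Q)"
proof -
  have "pm_post (hom_space V W) (hom_space (sobj P V) (sobj Q W)) (compose (carrier (sobj P V)) (\<eta> W)) (smap P V W)
        = pm_post (hom_space V W) (hom_space (sobj P V) (sobj Q W))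
            (\<lambda>\<psi>. compose (carrier (sobj P V)) \<psi> (\<eta> V)) (smap Q V W)
      \<longleftrightarrow> (\<forall>f\<in>carrier (hom_space V W).
        compose (carrier (sobj P V)) (\<eta> W) (fmap (forget P) V W f)
          = compose (carrier (sobj P V)) (fmap (forget Q) V W f) (\<eta> V))"
    if \<eta>: "\<eta> \<in> carrier (family_space (sobj P) (sobj Q))" and V: "V \<in> fin_vec" and W: "W \<in> fin_vec"
    for \<eta> V W
  proof -
    have obj: "kspace (sobj P V)" "kspace (sobj P W)" "kspace (sobj Q V)" "kspace (sobj Q W)"
      using strict_poly_functorD(1) P Q V W by blast+
    have vw: "kspace V" "kspace W"
      using V W by (auto intro: fin_vec_kspace)
    obtain D where D: "coordinates (hom_space V W) D"
      using coordinates_hom_space[OF vw] coordinates_exist[OF V] coordinates_exist[OF W] by blast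
    have eta: "\<eta> X \<in> LinearCombinations.module_hom class_ring (sobj P X) (sobj Q X)" if "X \<in> fin_vec" for X
      using \<eta> that by (auto simp: family_space_def PiE_iff)
    show ?thesis
      using pm_post_eq_iff_pointwise[OF k kspace_hom_space[OF vw] D
          kspace_hom_space[OF obj(1,2)] kspace_hom_space[OF obj(3,4)] kspace_hom_space[OF obj(1,4)]
          compose_post_module_hom[OF eta[OF W] obj(1)] compose_pre_module_hom[OF eta[OF V] obj(1)]
          strict_poly_functorD(2)[OF P(1) V W] _ strict_poly_functorD(2)[OF Q(1) V W]]
        P(2) Q(2) V W
      by (simp add: homogeneous_functor_def forget_def)
  qed
  then show ?thesis
    unfolding strict_Hom_def vect_Hom_def fobj_forget
    by (intro arg_cong[of _ _ "\<lambda>C. family_space (sobj P) (sobj Q)\<lparr>carrier := C\<rparr>"]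
        Collect_cong conj_cong ball_cong refl)
qed

theorem proposition1p4:
  fixes P :: "('k::field, 'v, 'w) strict_functor"
    and Q :: "('k, 'v, 'u) strict_functor"
    and p d :: nat
  assumes "CHAR('k) = p" and "p > 0"
    and "infinite (UNIV :: 'k set) \<or> d \<le> card (UNIV :: 'k set)"
    and "strict_poly_functor P" and "homogeneous_functor d P"
    and "strict_poly_functor Q" and "homogeneous_functor d Q"
  shows "linear_map class_ring (strict_Hom P Q) (vect_Hom (forget P) (forget Q)) forget_morphism
    \<and> bij_betw forget_morphism (carrier (strict_Hom P Q)) (carrier (vect_Hom (forget P) (forget Q)))"
proof -
  let ?S = "strict_Hom P Q"
  have eq: "?S = vect_Hom (forget P) (forget Q)"
    by (rule strict_Hom_eq_vect_Hom[OF assms(3-7)])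
  have "kspace (vect_Hom (forget P) (forget Q))"
    by (rule kspace_vect_Hom)
      (use strict_poly_functorD(1) assms(4,6) fmap_forget_closed[OF assms(4)] fmap_forget_closed[OF assms(6)]
        in \<open>auto simp del: hom_space_simps\<close>)
  then have "linear_map class_ring ?S ?S (\<lambda>\<eta>. \<eta>)"
    unfolding eq by (rule linear_map_id)
  moreover have id: "forget_morphism = (\<lambda>\<eta> :: ('k, 'v) module \<Rightarrow> 'w \<Rightarrow> 'u. \<eta>)"
    by (simp add: forget_morphism_def fun_eq_iff)
  ultimately show ?thesis
    unfolding eq id by (simp add: bij_betw_def inj_on_def)
qed

end
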